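(* Let $n\ge1$. The only nonempty non-trivial symmetry class of spanning trees of the Aztec diamond $AD_n$ is that of horizontally symmetric trees; that is, $\mathrm{t}_{\langle h,v\rangle}(AD_n)=\mathrm{t}_{\langle r^2\rangle}(AD_n)=\mathrm{t}_{\langle r\rangle}(AD_n)=0$, while $$\mathrm{t}_{\langle h\rangle}(AD_n)=2n\,\mathrm{t}(HMD_n)=2n \prod_{\substack{1\leq j<k\leq 2n-1\\ j+k\leq 2n-1}}\left(4-4\cos\frac{j\pi}{2n}\cos\frac{k\pi}{2n}\right).$$
   Context: The Aztec diamond $AD_n$ is the subgraph of the grid $(\mathbb{Z}+1/2)^2$ (nearest-neighbor edges) induced by the vertices $(x,y)$ with $|x|+|y|\le n$. Let $h$, $v$, $r$ denote the symmetries of $AD_n$ given by reflection across the horizontal axis, reflection across the vertical axis, and rotation by $90^\circ$ about the center, respectively. For a graph $G$, $\mathrm{t}(G)$ is the number of spanning trees of $G$, and $\mathrm{t}_H(G)$ is the number of spanning trees of $G$ invariant under the action of the group of symmetries $H$. No spanning tree of $AD_n$ is symmetric about an axis making a $45^\circ$ angle with the horizontal, so the inequivalent non-trivial symmetry classes considered are those of the subgroups $\langle h\rangle$, $\langle h,v\rangle$, $\langle r^2\rangle$, $\langle r\rangle$. The mixed Aztec diamond $MD_n$ is the graph whose vertices are the black unit squares of a $2n\times 2n$ chessboard, two vertices being adjacent if the corresponding squares share a corner. $HMD_n$ is the subgraph of $MD_n$ induced by the black squares on or above the black diagonal of the board (the main diagonal consisting of black squares). Empty products equal $1$. *)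

theory Defs
  imports Complex_Main "HOL-Algebra.Bij" "HOL-Algebra.Generated_Groups" "Graph_Theory.Graph_Theory"
begin

text \<open>
  As in \<^theory>\<open>Graph_Theory.Digraph\<close>, an undirected graph is a symmetric digraph: each edge is
  a pair of opposite arcs.
\<close>

text \<open>
  Spanning trees in the undirected sense.  The library's \<^const>\<open>spanning_tree\<close> is a notion for
  digraphs and does not fit here: its \<^const>\<open>forest\<close> forbids all directed cycles, so in a symmetric
  digraph the two arcs of a single edge already violate it, whereas an acyclic orientation of a
  triangle satisfies it.  In a symmetric digraph without loops and parallel arcs, the cycles of the
  undirected graph are the directed cycles of length at least 3.
\<close>

definition undirected_spanning_tree :: "('a, 'b) pre_digraph \<Rightarrow> ('a, 'b) pre_digraph \<Rightarrow> bool" where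
  "undirected_spanning_tree T G \<longleftrightarrow>
     spanning T G \<and> symmetric T \<and> Digraph_Component.connected T \<and>
     \<not> (\<exists>p. pre_digraph.cycle T p \<and> 3 \<le> length p)"

definition num_spanning_trees :: "('a, 'b) pre_digraph \<Rightarrow> nat" where
  "num_spanning_trees G = card {T. undirected_spanning_tree T G}"

definition graph_invariant :: "('a \<Rightarrow> 'a) \<Rightarrow> ('a, 'b) pre_digraph \<Rightarrow> bool" where
  "graph_invariant \<sigma> T \<longleftrightarrow>
     \<sigma> ` verts T = verts T \<and> map_prod \<sigma> \<sigma> ` arcs_ends T = arcs_ends T"

definition num_invariant_spanning_trees :: "('a \<Rightarrow> 'a) set \<Rightarrow> ('a, 'b) pre_digraph \<Rightarrow> nat" where
  "num_invariant_spanning_trees H G =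
     card {T. undirected_spanning_tree T G \<and> (\<forall>\<sigma>\<in>H. graph_invariant \<sigma> T)}"

definition half_grid :: "(real \<times> real, (real \<times> real) \<times> (real \<times> real)) pre_digraph" where
  "half_grid = (let V = {(of_int i + 1/2, of_int j + 1/2) | i j :: int. True} in
     with_proj \<lparr> pverts = V,
       parcs = {((x, y), (x', y')). (x, y) \<in> V \<and> (x', y') \<in> V \<and> \<bar>x - x'\<bar> + \<bar>y - y'\<bar> = 1} \<rparr>)"

definition aztec_diamond ::
    "nat \<Rightarrow> (real \<times> real, (real \<times> real) \<times> (real \<times> real)) pre_digraph" where
  "aztec_diamond n = half_grid \<restriction> {(x, y) \<in> verts half_grid. \<bar>x\<bar> + \<bar>y\<bar> \<le> real n}"

definition refl_h :: "real \<times> real \<Rightarrow> real \<times> real" where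
  "refl_h = (\<lambda>(x, y). (x, - y))"

definition refl_v :: "real \<times> real \<Rightarrow> real \<times> real" where
  "refl_v = (\<lambda>(x, y). (- x, y))"

definition rot90 :: "real \<times> real \<Rightarrow> real \<times> real" where
  "rot90 = (\<lambda>(x, y). (- y, x))"

text \<open>The symmetries act on the whole plane; the group is taken inside the bijections of the plane.\<close>

definition sym_group :: "(real \<times> real \<Rightarrow> real \<times> real) set \<Rightarrow> (real \<times> real \<Rightarrow> real \<times> real) set" where
  "sym_group S = generate (BijGroup UNIV) S"

text \<open>
  The pair \<open>(i, j)\<close> stands for the unit square \<open>[i, i + 1] \<times> [j, j + 1]\<close> of the board
  \<open>[0, 2n] \<times> [0, 2n]\<close>, so \<open>i\<close> counts columns from the left and \<open>j\<close> rows from the bottom.  Colours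
  are chosen so that the diagonal \<open>i = j\<close> is black; the squares above it are those with \<open>i < j\<close>.
\<close>

definition black_squares :: "nat \<Rightarrow> (nat \<times> nat) set" where
  "black_squares n = {(i, j). i < 2 * n \<and> j < 2 * n \<and> even (i + j)}"

definition corners :: "nat \<times> nat \<Rightarrow> (nat \<times> nat) set" where
  "corners = (\<lambda>(i, j). {i, i + 1} \<times> {j, j + 1})"

definition mixed_aztec_diamond :: "nat \<Rightarrow> (nat \<times> nat, (nat \<times> nat) \<times> (nat \<times> nat)) pre_digraph" where
  "mixed_aztec_diamond n = with_proj
     \<lparr> pverts = black_squares n,
       parcs = {(s, t). s \<in> black_squares n \<and> t \<in> black_squares n \<and> s \<noteq> t \<and>
                  corners s \<inter> corners t \<noteq> {}} \<rparr>"

definition half_mixed_aztec_diamond ::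
    "nat \<Rightarrow> (nat \<times> nat, (nat \<times> nat) \<times> (nat \<times> nat)) pre_digraph" where
  "half_mixed_aztec_diamond n = mixed_aztec_diamond n \<restriction> {(i, j) \<in> black_squares n. i \<le> j}"

end

theory Submission
  imports Defs "Jordan_Normal_Form.Determinant"
begin

text \<open>
  A tree on \<open>N\<close> vertices has \<open>2 (N - 1)\<close> arcs.  The half-turn acts freely on the vertices, and
  together with reversal it acts freely on the arcs of an invariant tree, in orbits of size 4; but
  \<open>N\<close> is even, so \<open>2 (N - 1)\<close> is not divisible by 4.  A horizontally symmetric tree contains exactly
  one of the \<open>2 n\<close> edges crossing the axis and is determined by it and by its upper half, a spanning
  tree of the upper half of the diamond, which is a copy of \<open>HMD\<^sub>n\<close>.

  All bounded faces of \<open>HMD\<^sub>n\<close> are squares.  Letting each face choose one of its four sides so that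
  following the choices leads from every face to the outer one, the unchosen edges form a spanning
  tree, and each spanning tree arises once.  Expanding \<open>det (4 I - M)\<close>, with \<open>M\<close> the adjacency
  matrix of the bounded faces, by multilinearity in the rows counts these choices.  The eigenvectors
  of \<open>M\<close> are products of sines made antisymmetric about the diagonal of the board.
\<close>

section \<open>Trees as sets of arcs\<close>

text \<open>The count is made on the dual graph because of the border. Vertices lose neighbours
  along the sides of the half board, so in general its Laplacian has no constant diagonal. All
  bounded faces have exactly four sides, and removing the outer face leaves \<open>4 I - M\<close>
  with zero boundary values, which sines can satisfy. Neighbouring faces lie diagonally, so the sum
  over neighbours is a product, not a sum, of one-dimensional operators; hence the product of two
  cosines. The zero lines bound a right triangle with legs \<open>2 n\<close>, which gives the
  angles \<open>j pi / (2 n)\<close> and the need to antisymmetrise. That every face has a way out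
  across edges not in the tree is a discrete Jordan curve theorem; it is settled by a parity count.
  Elsewhere Euler's formula replaces topology.\<close>

text \<open>Acyclicity is expressed by saying that every edge is a bridge.\<close>

definition tree_on :: "'a set \<Rightarrow> ('a \<times> 'a) set \<Rightarrow> bool" where
  "tree_on V R \<longleftrightarrow> R \<subseteq> V \<times> V \<and> sym R \<and> V \<times> V \<subseteq> R\<^sup>* \<and>
     (\<forall>u v. (u, v) \<in> R \<longrightarrow> (u, v) \<notin> (R - {(u, v), (v, u)})\<^sup>*)"

section \<open>Reachability, simple paths and bridges\<close>

lemma rtrancl_on_eq_rtrancl:
  assumes "R \<subseteq> V \<times> V" "u \<in> V"
  shows "(u, v) \<in> rtrancl_on V R \<longleftrightarrow> (u, v) \<in> R\<^sup>*"
proof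
  assume "(u, v) \<in> rtrancl_on V R"
  then show "(u, v) \<in> R\<^sup>*"
    by induction (auto intro: rtrancl_into_rtrancl)
next
  assume "(u, v) \<in> R\<^sup>*"
  then show "(u, v) \<in> rtrancl_on V R"
    by induction (use assms in \<open>auto intro: rtrancl_on_into_rtrancl_on\<close>)
qed

text \<open>An arc may go to a whole path or to a single point, since only \<open>Q\<^sup>*\<close>
  is asked for; folding along the axis collapses the crossing arcs in this way.\<close>

lemma rtrancl_map:
  assumes "(u, v) \<in> R\<^sup>*" and "\<And>x y. (x, y) \<in> R \<Longrightarrow> (f x, f y) \<in> Q\<^sup>*"
  shows "(f u, f v) \<in> Q\<^sup>*"
  using assms(1) by induction (auto dest: assms(2) intro: rtrancl_trans)

lemma pcas_rtrancl: "pcas u p v \<Longrightarrow> set p \<subseteq> R \<Longrightarrow> (u, v) \<in> R\<^sup>*"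
  by (induction p arbitrary: u) (auto intro: converse_rtrancl_into_rtrancl)

lemma pawalk_verts_conv: "pcas u p v \<Longrightarrow> pawalk_verts u p = u # map snd p"
  by (induction p arbitrary: u) auto

lemma rtrancl_pcas_distinct:
  assumes "(u, v) \<in> R\<^sup>*"
  shows "\<exists>p. pcas u p v \<and> set p \<subseteq> R \<and> distinct (u # map snd p)"
  using assms
proof (induction rule: converse_rtrancl_induct)
  case base
  show ?case by (rule exI[of _ "[]"]) simp
next
  case (step y z)
  then obtain p where p: "pcas z p v" "set p \<subseteq> R" "distinct (z # map snd p)" by blast
  show ?case
  proof (cases "y \<in> set (z # map snd p)")
    case False
    with p step show ?thesis by (intro exI[of _ "(y, z) # p"]) auto
  next
    case y: True
    \<comment> \<open>The path already visits \<open>y\<close>; its part before that visit is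
      dropped, as prefixing \<open>(y, z)\<close> would create a loop.\<close>
    have "\<exists>q. pcas y q v \<and> set q \<subseteq> set p \<and> distinct (y # map snd q)"
      using p(1,3) y
    proof (induction p arbitrary: z)
      case (Cons a p)
      show ?case
      proof (cases "y = z")
        case True
        with Cons.prems show ?thesis by blast
      next
        case False
        with Cons.prems have "pcas (snd a) p v" "distinct (snd a # map snd p)"
          "y \<in> set (snd a # map snd p)" by auto
        from Cons.IH[OF this] show ?thesis by auto
      qed
    qed auto
    with p(2) show ?thesis by blast
  qed
qed

text \<open>A simple path that avoids an edge closes up with it to a cycle; conversely the rest of a
  cycle bypasses its first arc. Length at least 3 excludes the walk to and fro along one
  edge.\<close>

lemma bridge_iff_no_cycle:
  assumes R: "R \<subseteq> V \<times> V" "sym R" "irrefl R"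
  shows "(\<forall>u v. (u, v) \<in> R \<longrightarrow> (u, v) \<notin> (R - {(u, v), (v, u)})\<^sup>*) \<longleftrightarrow>
    \<not> (\<exists>p. pre_digraph.cycle (with_proj \<lparr> pverts = V, parcs = R \<rparr>) p \<and> 3 \<le> length p)"
    (is "?B \<longleftrightarrow> \<not> ?C")
proof -
  interpret pair_pre_digraph "\<lparr> pverts = V, parcs = R \<rparr>" .
  have cyc: "cycle p \<longleftrightarrow> (\<exists>u. u \<in> V \<and> set p \<subseteq> R \<and> pcas u p u \<and> distinct (map snd p) \<and> p \<noteq> [])" for p
    unfolding cycle_def awalk_def by (auto simp: pawalk_verts_conv)
  have "?C" if "\<not> ?B"
  proof -
    from that obtain u v where uv: "(u, v) \<in> R" "(u, v) \<in> (R - {(u, v), (v, u)})\<^sup>*" by blast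
    obtain p where p: "pcas u p v" "set p \<subseteq> R - {(u, v), (v, u)}" "distinct (u # map snd p)"
      using rtrancl_pcas_distinct[OF uv(2)] by blast
    have "u \<noteq> v" using uv(1) R(3) by (auto simp: irrefl_def)
    \<comment> \<open>\<open>u \<noteq> v\<close> rules out the empty path and the deleted arc a
      path of length one; the closing arc then makes the length 3.\<close>
    have "2 \<le> length p"
      using p(1,2) \<open>u \<noteq> v\<close> by (cases p rule: list.exhaust[case_product list.exhaust[of "tl p"]]) auto
    have vu: "(v, u) \<in> R" using uv R(2) by (auto dest: symD)
    have "pcas v ((v, u) # p) v" using p(1) by simp
    moreover have "distinct (map snd ((v, u) # p))" using p(3) by simp
    moreover have "set ((v, u) # p) \<subseteq> R" using p(2) vu by auto
    moreover have "v \<in> V" using vu R by auto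
    ultimately show ?C using \<open>2 \<le> length p\<close> unfolding cyc
      by (intro exI[of _ "(v, u) # p"]) auto
  qed
  moreover have False if ?B ?C
  proof -
    from \<open>?C\<close> obtain p u where p: "set p \<subseteq> R" "pcas u p u" "distinct (map snd p)" "3 \<le> length p"
      unfolding cyc by blast
    obtain a e q where ae: "p = a # e # q" "q \<noteq> []"
      using p(4) by (auto simp: numeral_3_eq_3 Suc_le_length_iff)
    then obtain v where pe: "p = (u, v) # e # q" "q \<noteq> []"
      using p(2) by (cases a) auto
    obtain w where e: "e = (v, w)" using p(2) pe by (cases e) auto
    have "snd (last p) = u"
    proof -
      have "pcas u p x \<Longrightarrow> p \<noteq> [] \<Longrightarrow> snd (last p) = x" for u x and p :: "('a \<times> 'a) list"
        by (induction p arbitrary: u) auto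
      then show ?thesis using p(2) pe by blast
    qed
    then have lq: "u \<in> snd ` set q" using pe last_in_set[OF pe(2)] by auto
    \<comment> \<open>The tail of an arc of a walk is the start of the walk or the head of one of
      its arcs. In the cycle \<open>v\<close> is the head of the first arc only, so
      \<open>q\<close>, which starts after the second arc, never touches \<open>v\<close>.\<close>
    have fsts: "pcas s r t \<Longrightarrow> x \<in> set r \<Longrightarrow> fst x = s \<or> fst x \<in> snd ` set r"
      for s r t and x :: "'a \<times> 'a"
    proof (induction r arbitrary: s)
      case (Cons a r)
      then show ?case by (cases "x = a") auto
    qed simp
    have vR: "(w, u) \<in> (R - {(u, v), (v, u)})\<^sup>*"
    proof (rule pcas_rtrancl)
      show "pcas w q u" using p(2) pe e by simp
      have "x \<noteq> (u, v) \<and> x \<noteq> (v, u)" if "x \<in> set q" for x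
      proof -
        have "v \<notin> snd ` set q" "w \<noteq> v" using p(3) pe e by auto
        then show ?thesis using fsts[OF \<open>pcas w q u\<close> that] that by (cases x) force
      qed
      then show "set q \<subseteq> R - {(u, v), (v, u)}" using p(1) pe by fastforce
    qed
    have "w \<noteq> u" using lq p(3) pe e by auto
    moreover have "v \<noteq> u" using lq p(3) pe by auto
    ultimately have "(v, w) \<in> R - {(u, v), (v, u)}" using p(1) pe e by auto
    then have "(v, u) \<in> (R - {(u, v), (v, u)})\<^sup>*"
      using vR by (rule converse_rtrancl_into_rtrancl)
    moreover have "(v, u) \<in> R" using p(1) pe R(2) by (auto dest: symD)
    ultimately show False using \<open>?B\<close> by (metis insert_commute)
  qed
  ultimately show ?thesis by blast
qed
text \<open>Compatibility forces the tail and head maps of a subgraph to be the two projections, so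
  a spanning subgraph is nothing but its arc set. The symmetrisation inside \<open>connected\<close>
  leaves a symmetric \<open>R\<close> as it is.\<close>

lemma undirected_spanning_tree_iff:
  assumes "A \<subseteq> V \<times> V" "irrefl A" "V \<noteq> {}"
  shows "undirected_spanning_tree T (with_proj \<lparr> pverts = V, parcs = A \<rparr>) \<longleftrightarrow>
    (\<exists>R \<subseteq> A. tree_on V R \<and> T = with_proj \<lparr> pverts = V, parcs = R \<rparr>)"
proof -
  let ?G = "with_proj \<lparr> pverts = V, parcs = A \<rparr>"
  let ?T = "\<lambda>R. with_proj \<lparr> pverts = V, parcs = R \<rparr>"
  have sp: "spanning T ?G \<longleftrightarrow> (\<exists>R \<subseteq> A. T = ?T R)" for T
  proof
    assume "spanning T ?G"
    then have "T = ?T (arcs T)" "arcs T \<subseteq> A"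
      unfolding spanning_def subgraph_def compatible_def by (auto simp: with_proj_def)
    then show "\<exists>R \<subseteq> A. T = ?T R" by blast
  next
    have "R \<subseteq> A \<Longrightarrow> spanning (?T R) ?G" for R
    proof -
      assume "R \<subseteq> A"
      with assms(1) have "R \<subseteq> V \<times> V" by blast
      with assms(1) \<open>R \<subseteq> A\<close> show "spanning (?T R) ?G"
        by (force simp: spanning_def subgraph_def compatible_def wf_digraph_def)
    qed
    then show "\<exists>R \<subseteq> A. T = ?T R \<Longrightarrow> spanning T ?G" by blast
  qed
  have *: "undirected_spanning_tree (?T R) ?G \<longleftrightarrow> tree_on V R" if "R \<subseteq> A" for R
  proof -
    have R: "R \<subseteq> V \<times> V" "irrefl R" using that assms by (auto simp: irrefl_def)
    have "spanning (?T R) ?G" unfolding sp using that by blast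
    moreover have "Digraph_Component.connected (?T R) \<longleftrightarrow> V \<times> V \<subseteq> R\<^sup>*" if "sym R"
    proof -
      have "(\<Union>e\<in>R. {(fst e, snd e), (snd e, fst e)}) = R" (is "?L = R")
      proof
        show "?L \<subseteq> R" using symD[OF that] by auto
      qed auto
      then have "Digraph_Component.connected (?T R) \<longleftrightarrow> (\<forall>u\<in>V. \<forall>v\<in>V. (u, v) \<in> rtrancl_on V R)"
        using assms(3)
        by (simp add: connected_def strongly_connected_def mk_symmetric_def reachable_def)
      also have "\<dots> \<longleftrightarrow> (\<forall>u\<in>V. \<forall>v\<in>V. (u, v) \<in> R\<^sup>*)"
        by (simp add: rtrancl_on_eq_rtrancl[OF R(1)])
      finally show ?thesis by blast
    qed
    moreover define B where "B \<longleftrightarrow> (\<forall>u v. (u, v) \<in> R \<longrightarrow> (u, v) \<notin> (R - {(u, v), (v, u)})\<^sup>*)"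
    moreover define C where "C \<longleftrightarrow> (\<exists>p. pre_digraph.cycle (?T R) p \<and> 3 \<le> length p)"
    moreover have "sym R \<Longrightarrow> B \<longleftrightarrow> \<not> C"
      unfolding B_def C_def by (rule bridge_iff_no_cycle[OF R(1) _ R(2)])
    moreover have "tree_on V R \<longleftrightarrow> sym R \<and> V \<times> V \<subseteq> R\<^sup>* \<and> B"
      unfolding tree_on_def B_def using R(1) by simp
    moreover have "undirected_spanning_tree (?T R) ?G \<longleftrightarrow>
        spanning (?T R) ?G \<and> sym R \<and> Digraph_Component.connected (?T R) \<and> \<not> C"
      unfolding undirected_spanning_tree_def C_def symmetric_def by simp
    ultimately show ?thesis by argo
  qed
  show ?thesis
  proof
    assume T: "undirected_spanning_tree T ?G"
    then obtain R where R: "R \<subseteq> A" "T = ?T R"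
      using sp by (auto simp: undirected_spanning_tree_def)
    with T * show "\<exists>R \<subseteq> A. tree_on V R \<and> T = ?T R" by metis
  next
    assume "\<exists>R \<subseteq> A. tree_on V R \<and> T = ?T R"
    then show "undirected_spanning_tree T ?G" using * by metis
  qed
qed

lemma inj_with_proj: "inj (\<lambda>R. with_proj \<lparr> pverts = V, parcs = R \<rparr>)"
  by (auto simp: inj_def with_proj_def)

lemma num_spanning_trees_eq:
  assumes "A \<subseteq> V \<times> V" "irrefl A" "V \<noteq> {}"
  shows "num_spanning_trees (with_proj \<lparr> pverts = V, parcs = A \<rparr>) = card {R. R \<subseteq> A \<and> tree_on V R}"
proof -
  have "{T. undirected_spanning_tree T (with_proj \<lparr> pverts = V, parcs = A \<rparr>)} =
      (\<lambda>R. with_proj \<lparr> pverts = V, parcs = R \<rparr>) ` {R. R \<subseteq> A \<and> tree_on V R}"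
    using undirected_spanning_tree_iff[OF assms] by blast
  then show ?thesis
    unfolding num_spanning_trees_def
    by (simp add: card_image[OF inj_on_subset[OF inj_with_proj]])
qed

lemma num_invariant_spanning_trees_eq:
  assumes "A \<subseteq> V \<times> V" "irrefl A" "V \<noteq> {}" and "\<And>\<sigma>. \<sigma> \<in> H \<Longrightarrow> \<sigma> ` V = V"
  shows "num_invariant_spanning_trees H (with_proj \<lparr> pverts = V, parcs = A \<rparr>) =
    card {R. R \<subseteq> A \<and> tree_on V R \<and> (\<forall>\<sigma>\<in>H. map_prod \<sigma> \<sigma> ` R = R)}"
proof -
  have "{T. undirected_spanning_tree T (with_proj \<lparr> pverts = V, parcs = A \<rparr>) \<and> (\<forall>\<sigma>\<in>H. graph_invariant \<sigma> T)} =
      (\<lambda>R. with_proj \<lparr> pverts = V, parcs = R \<rparr>) `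
        {R. R \<subseteq> A \<and> tree_on V R \<and> (\<forall>\<sigma>\<in>H. map_prod \<sigma> \<sigma> ` R = R)}"
  proof -
    have "graph_invariant \<sigma> (with_proj \<lparr> pverts = V, parcs = R \<rparr>) \<longleftrightarrow> map_prod \<sigma> \<sigma> ` R = R"
      if "\<sigma> \<in> H" for \<sigma> R
      by (simp add: graph_invariant_def assms(4)[OF that])
    then show ?thesis
      by (auto simp: undirected_spanning_tree_iff[OF assms(1-3)] simp del: map_prod_imageI)
  qed
  then show ?thesis
    unfolding num_invariant_spanning_trees_def
    by (simp add: card_image[OF inj_on_subset[OF inj_with_proj]])
qed

lemma with_proj_restrict:
  "with_proj G \<restriction> U = with_proj \<lparr> pverts = U, parcs = parcs G \<inter> U \<times> U \<rparr>"
  by (auto simp: induce_subgraph_def with_proj_def)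

text \<open>The blocks form a partition, given through representatives. They will be orbits under
  the half-turn, and the two views of an edge from the faces beside it.\<close>

lemma dvd_card_blocks:
  assumes "finite S" and "\<And>x. x \<in> S \<Longrightarrow> B x \<subseteq> S \<and> x \<in> B x \<and> card (B x) = k"
    and "\<And>x y. x \<in> S \<Longrightarrow> y \<in> B x \<Longrightarrow> B y = B x"
  shows "k dvd card S"
proof -
  have un: "\<Union>(B ` S) = S" using assms(2) by blast
  have "k * card (B ` S) = card (\<Union>(B ` S))"
  proof (rule card_partition)
    show "finite (\<Union>(B ` S))" by (simp add: un assms(1))
    fix c d assume "c \<in> B ` S" "d \<in> B ` S" "c \<noteq> d"
    then obtain x y where xy: "x \<in> S" "y \<in> S" "c = B x" "d = B y" by blast
    then show "c \<inter> d = {}"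
      using assms(3)[OF xy(1)] assms(3)[OF xy(2)] \<open>c \<noteq> d\<close> by blast
  qed (use assms(1,2) in auto)
  then show ?thesis by (metis un dvd_triv_left)
qed

section \<open>Edge counts of trees\<close>

lemma rtrancl_exit:
  assumes "(u, v) \<in> R\<^sup>*" "u \<in> W" "v \<notin> W"
  shows "\<exists>x y. (x, y) \<in> R \<and> x \<in> W \<and> y \<notin> W"
  using assms by (induction rule: converse_rtrancl_induct) auto

text \<open>Grown one vertex at a time: connectedness supplies an arc leaving the set
  \<open>W\<close> reached so far. Both directions of the characterisation of trees by their number
  of arcs rest on this subgraph.\<close>

lemma connected_skeleton:
  assumes "finite V" "V \<noteq> {}" "R \<subseteq> V \<times> V" "sym R" "V \<times> V \<subseteq> R\<^sup>*"
  obtains P where "P \<subseteq> R" "sym P" "V \<times> V \<subseteq> P\<^sup>*" "card P = 2 * (card V - 1)"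
proof -
  have "\<exists>W P. W \<subseteq> V \<and> card W = Suc k \<and> P \<subseteq> R \<inter> W \<times> W \<and> sym P \<and> W \<times> W \<subseteq> P\<^sup>* \<and> card P = 2 * k"
    if "k < card V" for k
    using that
  proof (induction k)
    case 0
    obtain r where "r \<in> V" using assms(2) by blast
    then show ?case by (intro exI[of _ "{r}"] exI[of _ "{}"]) (auto simp: sym_def)
  next
    case (Suc k)
    then obtain W P where W: "W \<subseteq> V" "card W = Suc k" "P \<subseteq> R \<inter> W \<times> W" "sym P"
      "W \<times> W \<subseteq> P\<^sup>*" "card P = 2 * k" by auto
    have fW: "finite W" using W(1) assms(1) by (rule finite_subset)
    have "W \<noteq> V" using W(2) Suc.prems by auto
    then obtain v where v: "v \<in> V" "v \<notin> W" using W(1) by blast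
    obtain u where u: "u \<in> W" using W(2) by (cases "W = {}") auto
    have "(u, v) \<in> R\<^sup>*" using u v W(1) assms(5) by auto
    then obtain x y where xy: "(x, y) \<in> R" "x \<in> W" "y \<notin> W"
      using rtrancl_exit u v(2) by metis
    have yV: "y \<in> V" using xy(1) assms(3) by auto
    let ?P = "insert (x, y) (insert (y, x) P)"
    have fP: "finite P" using W(3) fW by (meson finite_SigmaI finite_subset le_inf_iff)
    have Pm: "P\<^sup>* \<subseteq> ?P\<^sup>*" by (rule rtrancl_mono) auto
    have to_x: "(a, x) \<in> ?P\<^sup>*" "(x, a) \<in> ?P\<^sup>*" if "a \<in> insert y W" for a
    proof -
      have "(a, x) \<in> ?P\<^sup>* \<and> (x, a) \<in> ?P\<^sup>*"
      proof (cases "a = y")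
        case True
        then show ?thesis by auto
      next
        case False
        then have "(a, x) \<in> P\<^sup>*" "(x, a) \<in> P\<^sup>*" using that xy(2) W(5) by auto
        then show ?thesis using Pm by blast
      qed
      then show "(a, x) \<in> ?P\<^sup>*" "(x, a) \<in> ?P\<^sup>*" by auto
    qed
    have "insert y W \<times> insert y W \<subseteq> ?P\<^sup>*"
      using to_x by (auto intro: rtrancl_trans)
    moreover have "card ?P = 2 * Suc k"
    proof -
      have "(x, y) \<notin> P" "(y, x) \<notin> P" "x \<noteq> y" using W(3) xy by auto
      then show ?thesis using fP W(6) by simp
    qed
    moreover have "sym ?P" using W(4) by (auto simp: sym_def)
    moreover have "?P \<subseteq> R \<inter> insert y W \<times> insert y W"
      using W(3) xy symD[OF assms(4) xy(1)] by auto
    moreover have "card (insert y W) = Suc (Suc k)" using W(2) xy(3) fW by simp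
    moreover have "insert y W \<subseteq> V" using W(1) yV by simp
    ultimately show ?case by blast
  qed
  from this[of "card V - 1"] obtain W P where W: "W \<subseteq> V" "card W = card V" "P \<subseteq> R \<inter> W \<times> W"
    "sym P" "W \<times> W \<subseteq> P\<^sup>*" "card P = 2 * (card V - 1)"
    using assms(1,2) by (auto simp: card_gt_0_iff)
  then have "W = V" using assms(1) card_subset_eq by blast
  with W that show thesis by blast
qed

text \<open>An edge outside the skeleton is bypassed by the skeleton and so is no bridge; hence the
  tree equals its skeleton.\<close>

lemma tree_on_card:
  assumes "tree_on V R" "finite V" "V \<noteq> {}"
  shows "card R = 2 * (card V - 1)"
proof -
  have R: "R \<subseteq> V \<times> V" "sym R" "V \<times> V \<subseteq> R\<^sup>*"
    and br: "\<And>u v. (u, v) \<in> R \<Longrightarrow> (u, v) \<notin> (R - {(u, v), (v, u)})\<^sup>*"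
    using assms(1) unfolding tree_on_def by auto
  obtain P where P: "P \<subseteq> R" "sym P" "V \<times> V \<subseteq> P\<^sup>*" "card P = 2 * (card V - 1)"
    using connected_skeleton[OF assms(2,3) R] .
  have "R \<subseteq> P"
  proof (rule ccontr)
    assume "\<not> R \<subseteq> P"
    then obtain u v where uv: "(u, v) \<in> R" "(u, v) \<notin> P" by auto
    then have "P \<subseteq> R - {(u, v), (v, u)}" using P(1,2) by (auto dest: symD)
    then have "P\<^sup>* \<subseteq> (R - {(u, v), (v, u)})\<^sup>*" by (rule rtrancl_mono)
    moreover have "(u, v) \<in> P\<^sup>*" using uv R(1) P(3) by auto
    ultimately show False using br[OF uv(1)] by blast
  qed
  with P show ?thesis by simp
qed

text \<open>If an edge were bypassed, the graph without it would still be connected, and its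
  skeleton would have as many arcs as \<open>R\<close> while lying in a proper subset.\<close>

lemma tree_onI_card:
  assumes "R \<subseteq> V \<times> V" "sym R" "V \<times> V \<subseteq> R\<^sup>*" "finite V" "card R = 2 * (card V - 1)"
  shows "tree_on V R"
proof -
  have "(u, v) \<notin> (R - {(u, v), (v, u)})\<^sup>*" if uv: "(u, v) \<in> R" for u v
  proof
    let ?R = "R - {(u, v), (v, u)}"
    assume *: "(u, v) \<in> ?R\<^sup>*"
    have sR: "sym ?R" using assms(2) by (auto simp: sym_def)
    have "(v, u) \<in> ?R\<^sup>*" using symD[OF sym_rtrancl[OF sR] *] .
    with * have "R \<subseteq> ?R\<^sup>*" by auto
    then have "R\<^sup>* \<subseteq> ?R\<^sup>*" by (rule rtrancl_subset_rtrancl)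
    with assms(3) have "V \<times> V \<subseteq> ?R\<^sup>*" by blast
    moreover have "V \<noteq> {}" "?R \<subseteq> V \<times> V" using assms(1) uv by auto
    ultimately obtain P where P: "P \<subseteq> ?R" "card P = 2 * (card V - 1)"
      using connected_skeleton[OF assms(4) _ _ sR] by metis
    have fR: "finite R" using assms(1,4) by (meson finite_SigmaI finite_subset)
    have "card P \<le> card ?R" using P(1) fR by (simp add: card_mono)
    also have "\<dots> < card R" using fR uv by (intro psubset_card_mono) auto
    finally show False using P(2) assms(5) by simp
  qed
  then show ?thesis using assms(1-3) unfolding tree_on_def by auto
qed

lemma no_tree_invariant_under_free_involution:
  assumes "tree_on V R" "finite V" "V \<noteq> {}"
    and inv: "\<And>v. \<sigma> (\<sigma> v) = v" "\<sigma> ` V = V" "map_prod \<sigma> \<sigma> ` R = R"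
    and free: "\<And>v. v \<in> V \<Longrightarrow> \<sigma> v \<noteq> v" "\<And>v. (v, \<sigma> v) \<notin> R"
  shows False
proof -
  have R: "R \<subseteq> V \<times> V" "sym R" using assms(1) unfolding tree_on_def by auto
  have fR: "finite R" using R(1) assms(2) by (meson finite_SigmaI finite_subset)
  have "v \<noteq> \<sigma> v" if "v \<in> V" for v using free(1)[OF that] by simp
  then have "2 dvd card V"
    by (intro dvd_card_blocks[OF assms(2), of "\<lambda>v. {v, \<sigma> v}"])
      (use inv(1,2) in \<open>auto simp: card_insert_if\<close>)
  moreover have "4 dvd card R"
  proof (rule dvd_card_blocks[OF fR, of "\<lambda>(u, v). {(u, v), (v, u), (\<sigma> u, \<sigma> v), (\<sigma> v, \<sigma> u)}"])
    fix x assume x: "x \<in> R"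
    obtain u v where uv: "x = (u, v)" by fastforce
    have s: "(\<sigma> a, \<sigma> b) \<in> R" if "(a, b) \<in> R" for a b
      using inv(3) that by (metis map_prod_imageI)
    \<comment> \<open>A loop is never a bridge, as reachability is reflexive.\<close>
    have "u \<noteq> v"
      using x uv assms(1) unfolding tree_on_def by auto
    moreover have "\<sigma> u \<noteq> \<sigma> v" using inv(1) \<open>u \<noteq> v\<close> by metis
    moreover have "\<sigma> u \<noteq> u" "\<sigma> v \<noteq> v" using free(1) x uv R(1) by auto
    moreover have "v \<noteq> \<sigma> u" "u \<noteq> \<sigma> v" using free(2)[of u] x uv inv(1)[of v] by auto
    moreover have "(v, u) \<in> R" using x uv R(2) by (auto dest: symD)
    ultimately show "(case x of (u, v) \<Rightarrow> {(u, v), (v, u), (\<sigma> u, \<sigma> v), (\<sigma> v, \<sigma> u)}) \<subseteq> R \<and>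
        x \<in> (case x of (u, v) \<Rightarrow> {(u, v), (v, u), (\<sigma> u, \<sigma> v), (\<sigma> v, \<sigma> u)}) \<and>
        card (case x of (u, v) \<Rightarrow> {(u, v), (v, u), (\<sigma> u, \<sigma> v), (\<sigma> v, \<sigma> u)}) = 4"
      using x uv s by (auto simp: card_insert_if)
  next
    fix x y assume "y \<in> (case x of (u, v) \<Rightarrow> {(u, v), (v, u), (\<sigma> u, \<sigma> v), (\<sigma> v, \<sigma> u)})"
    then show "(case y of (u, v) \<Rightarrow> {(u, v), (v, u), (\<sigma> u, \<sigma> v), (\<sigma> v, \<sigma> u)}) =
        (case x of (u, v) \<Rightarrow> {(u, v), (v, u), (\<sigma> u, \<sigma> v), (\<sigma> v, \<sigma> u)})"
      by (cases x) (auto simp: inv(1))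
  qed
  moreover have "card V \<noteq> 0" using assms(2,3) by simp
  ultimately show False
    using tree_on_card[OF assms(1-3)] by presburger
qed

section \<open>Transport along injections\<close>

lemma tree_on_image:
  assumes "inj_on f V" "tree_on V R"
  shows "tree_on (f ` V) (map_prod f f ` R)"
proof -
  have R: "R \<subseteq> V \<times> V" "sym R" "V \<times> V \<subseteq> R\<^sup>*"
    and br: "\<And>u v. (u, v) \<in> R \<Longrightarrow> (u, v) \<notin> (R - {(u, v), (v, u)})\<^sup>*"
    using assms(2) unfolding tree_on_def by auto
  have "(f u, f v) \<in> (map_prod f f ` R)\<^sup>*" if "(u, v) \<in> V \<times> V" for u v
    by (rule rtrancl_map[of u v R]) (use R(3) that in auto)
  moreover have "(f u, f v) \<notin> (map_prod f f ` R - {(f u, f v), (f v, f u)})\<^sup>*" if uv: "(u, v) \<in> R" for u v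
  proof
    let ?g = "inv_into V f"
    assume "(f u, f v) \<in> (map_prod f f ` R - {(f u, f v), (f v, f u)})\<^sup>*"
    then have "(?g (f u), ?g (f v)) \<in> (R - {(u, v), (v, u)})\<^sup>*"
    proof (rule rtrancl_map)
      fix x y assume "(x, y) \<in> map_prod f f ` R - {(f u, f v), (f v, f u)}"
      then obtain a b where "(a, b) \<in> R - {(u, v), (v, u)}" "x = f a" "y = f b" by auto
      then show "(?g x, ?g y) \<in> (R - {(u, v), (v, u)})\<^sup>*"
        using R(1) assms(1) by (auto simp: inv_into_f_f subset_iff)
    qed
    moreover have "u \<in> V" "v \<in> V" using uv R(1) by auto
    ultimately show False using br[OF uv] assms(1) by (simp add: inv_into_f_f)
  qed
  moreover have "sym (map_prod f f ` R)" using R(2) by (force simp: sym_def)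
  ultimately show ?thesis using R(1) unfolding tree_on_def by auto
qed

lemma card_trees_image:
  assumes f: "inj_on f V" and A: "A \<subseteq> V \<times> V"
  shows "card {R. R \<subseteq> map_prod f f ` A \<and> tree_on (f ` V) R} = card {R. R \<subseteq> A \<and> tree_on V R}"
proof -
  let ?F = "\<lambda>R. map_prod f f ` R" and ?g = "inv_into V f"
  have g: "map_prod ?g ?g ` ?F R = R" if "R \<subseteq> V \<times> V" for R
  proof -
    have "map_prod ?g ?g (map_prod f f p) = p" if "p \<in> R" for p
      using that \<open>R \<subseteq> V \<times> V\<close> f by (cases p) (auto simp: inv_into_f_f)
    then show ?thesis by (simp add: image_image)
  qed
  have i: "inj_on ?F {R. R \<subseteq> A \<and> tree_on V R}"
  proof (rule inj_on_inverseI)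
    show "map_prod ?g ?g ` ?F R = R" if "R \<in> {R. R \<subseteq> A \<and> tree_on V R}" for R
      by (rule g) (use that A in blast)
  qed
  have "?F ` {R. R \<subseteq> A \<and> tree_on V R} = {R. R \<subseteq> ?F A \<and> tree_on (f ` V) R}"
  proof
    show "?F ` {R. R \<subseteq> A \<and> tree_on V R} \<subseteq> {R. R \<subseteq> ?F A \<and> tree_on (f ` V) R}"
      using tree_on_image[OF f] by blast
    show "{R. R \<subseteq> ?F A \<and> tree_on (f ` V) R} \<subseteq> ?F ` {R. R \<subseteq> A \<and> tree_on V R}"
    proof clarify
      fix R assume R: "R \<subseteq> ?F A" "tree_on (f ` V) R"
      obtain B where B: "B \<subseteq> A" "R = ?F B" using R(1) by (meson subset_imageE)
      have "tree_on (?g ` f ` V) (map_prod ?g ?g ` R)"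
        by (rule tree_on_image[OF _ R(2)]) (rule inj_on_inv_into, simp)
      moreover have "?g ` f ` V = V" using f by (rule inv_into_image_cancel) simp
      ultimately have "tree_on V B" using g[of B] B A by auto
      then show "R \<in> ?F ` {R. R \<subseteq> A \<and> tree_on V R}" using B by blast
    qed
  qed
  then show ?thesis using card_image[OF i] by argo
qed

section \<open>Trees invariant under a reflection\<close>

text \<open>\<open>crossing\<close> is what makes folding work: an edge over the axis joins a vertex
  to its own mirror image, so folding collapses it to a point.\<close>

locale reflected_graph =
  fixes U :: "'a set" and \<sigma> :: "'a \<Rightarrow> 'a" and A :: "('a \<times> 'a) set"
  assumes finite_U: "finite U"
    and A_sub: "A \<subseteq> (U \<union> \<sigma> ` U) \<times> (U \<union> \<sigma> ` U)"
    and sym_A: "sym A"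
    and \<sigma>_\<sigma>[simp]: "\<sigma> (\<sigma> v) = v"
    and disj: "U \<inter> \<sigma> ` U = {}"
    and \<sigma>_A: "(u, v) \<in> A \<Longrightarrow> (\<sigma> u, \<sigma> v) \<in> A"
    and crossing: "(u, v) \<in> A \<Longrightarrow> u \<in> U \<Longrightarrow> v \<notin> U \<Longrightarrow> v = \<sigma> u"
begin

definition double :: "'a \<Rightarrow> ('a \<times> 'a) set \<Rightarrow> ('a \<times> 'a) set" where
  "double x S = S \<union> map_prod \<sigma> \<sigma> ` S \<union> {(x, \<sigma> x), (\<sigma> x, x)}"

lemma \<sigma>_U: "u \<in> U \<Longrightarrow> \<sigma> u \<notin> U"
  using disj by blast

lemma inj_\<sigma>: "inj \<sigma>"
  by (metis \<sigma>_\<sigma> injI)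

lemma double_Int:
  assumes "S \<subseteq> U \<times> U"
  shows "double x S \<inter> U \<times> U = S"
  using assms \<sigma>_U unfolding double_def by auto

lemma double_crossing:
  assumes "S \<subseteq> U \<times> U" "x \<in> U" "u \<in> U" "(u, \<sigma> u) \<in> double x S"
  shows "u = x"
  using assms \<sigma>_U unfolding double_def by auto

text \<open>The two halves are joined by the edge at \<open>x\<close>, and the arcs add up to
  \<open>4 (|U| - 1) + 2 = 2 (2 |U| - 1)\<close>, so the criterion by counting applies.\<close>

lemma tree_on_double:
  assumes S: "tree_on U S" and x: "x \<in> U"
  shows "tree_on (U \<union> \<sigma> ` U) (double x S)"
proof (rule tree_onI_card)
  have S': "S \<subseteq> U \<times> U" "sym S" "U \<times> U \<subseteq> S\<^sup>*" using S unfolding tree_on_def by auto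
  let ?D = "double x S"
  show "?D \<subseteq> (U \<union> \<sigma> ` U) \<times> (U \<union> \<sigma> ` U)"
    using S'(1) x unfolding double_def by auto
  show sD: "sym ?D"
    using S'(2) unfolding double_def sym_def by (auto simp: map_prod_def)
  have to_x: "(u, x) \<in> ?D\<^sup>*" if u: "u \<in> U \<union> \<sigma> ` U" for u
  proof (cases "u \<in> U")
    case True
    then have "(u, x) \<in> S\<^sup>*" using S'(3) x by auto
    moreover have "S\<^sup>* \<subseteq> ?D\<^sup>*" by (rule rtrancl_mono) (auto simp: double_def)
    ultimately show ?thesis by blast
  next
    case False
    then obtain w where w: "w \<in> U" "u = \<sigma> w" using u by blast
    then have "(w, x) \<in> S\<^sup>*" using S'(3) x by auto
    then have "(\<sigma> w, \<sigma> x) \<in> ?D\<^sup>*"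
      by (rule rtrancl_map) (auto simp: double_def)
    moreover have "(\<sigma> x, x) \<in> ?D" by (simp add: double_def)
    ultimately show ?thesis using w by (auto intro: rtrancl_into_rtrancl)
  qed
  then show "(U \<union> \<sigma> ` U) \<times> (U \<union> \<sigma> ` U) \<subseteq> ?D\<^sup>*"
    using symD[OF sym_rtrancl[OF sD]] by (auto intro: rtrancl_trans)
  show "finite (U \<union> \<sigma> ` U)" using finite_U by simp
  have fS: "finite S" using S'(1) finite_U by (meson finite_SigmaI finite_subset)
  have "card (map_prod \<sigma> \<sigma> ` S) = card S"
    by (rule card_image) (metis inj_\<sigma> inj_on_subset prod.inj_map subset_UNIV)
  moreover have "S \<inter> map_prod \<sigma> \<sigma> ` S = {}" using S'(1) \<sigma>_U by auto
  moreover have "(S \<union> map_prod \<sigma> \<sigma> ` S) \<inter> {(x, \<sigma> x), (\<sigma> x, x)} = {}"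
    using S'(1) \<sigma>_U x by auto
  moreover have "\<sigma> x \<noteq> x" using \<sigma>_U[OF x] x by auto
  ultimately have "card ?D = card S + card S + 2"
    unfolding double_def using fS by (simp add: card_Un_disjoint)
  moreover have "card S = 2 * (card U - 1)"
    using tree_on_card[OF S finite_U] x by blast
  moreover have "card (U \<union> \<sigma> ` U) = 2 * card U"
    using finite_U disj inj_\<sigma> by (simp add: card_Un_disjoint card_image inj_on_subset)
  \<comment> \<open>The subtractions are truncated, so the sum requires \<open>U\<close> to be
    nonempty.\<close>
  moreover have "card U \<ge> 1" using x finite_U card_gt_0_iff[of U] by (auto simp: Suc_le_eq)
  ultimately show "card ?D = 2 * (card (U \<union> \<sigma> ` U) - 1)" by simp
qed

text \<open>Folding takes paths of \<open>R\<close> to paths in the upper part, which is therefore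
  connected, and its edges remain bridges. Some edge must cross the axis; two of them, joined by a
  path above and its mirror image below, would bypass one another.\<close>

lemma invariant_tree_is_double:
  assumes RA: "R \<subseteq> A" and R: "tree_on (U \<union> \<sigma> ` U) R" and inv: "map_prod \<sigma> \<sigma> ` R = R" and ne: "U \<noteq> {}"
  shows "\<exists>x\<in>U. (x, \<sigma> x) \<in> A \<and> tree_on U (R \<inter> U \<times> U) \<and> R = double x (R \<inter> U \<times> U)"
proof -
  have R': "R \<subseteq> (U \<union> \<sigma> ` U) \<times> (U \<union> \<sigma> ` U)" "sym R" "(U \<union> \<sigma> ` U) \<times> (U \<union> \<sigma> ` U) \<subseteq> R\<^sup>*"
    and br: "\<And>u v. (u, v) \<in> R \<Longrightarrow> (u, v) \<notin> (R - {(u, v), (v, u)})\<^sup>*"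
    using R unfolding tree_on_def by auto
  have \<sigma>R: "(\<sigma> u, \<sigma> v) \<in> R" if "(u, v) \<in> R" for u v
    using inv that by (metis map_prod_imageI)
  have cr: "v = \<sigma> u" if "(u, v) \<in> R" "u \<in> U" "v \<notin> U" for u v
    using crossing RA that by blast
  let ?S = "R \<inter> U \<times> U"
  define \<phi> where "\<phi> v = (if v \<in> U then v else \<sigma> v)" for v
  have \<phi>: "(\<phi> u, \<phi> v) \<in> ?S\<^sup>*" if uv: "(u, v) \<in> R" for u v
  proof -
    consider "u \<in> U" "v \<in> U" | "u \<in> U" "v \<notin> U" | "u \<notin> U" "v \<in> U" | "u \<notin> U" "v \<notin> U" by blast
    then show ?thesis
    proof cases
      case 1
      then show ?thesis using uv by (auto simp: \<phi>_def)
    next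
      case 2
      then show ?thesis using cr[OF uv] by (auto simp: \<phi>_def)
    next
      case 3
      then show ?thesis using cr[OF symD[OF R'(2) uv]] by (auto simp: \<phi>_def)
    next
      case 4
      then have "\<sigma> u \<in> U" "\<sigma> v \<in> U" using R'(1) uv by auto
      then show ?thesis using 4 \<sigma>R[OF uv] by (auto simp: \<phi>_def)
    qed
  qed
  have connS: "U \<times> U \<subseteq> ?S\<^sup>*"
  proof
    fix p assume "p \<in> U \<times> U"
    then obtain u v where p: "p = (u, v)" "u \<in> U" "v \<in> U" by auto
    then have "(u, v) \<in> R\<^sup>*" using R'(3) by auto
    then have "(\<phi> u, \<phi> v) \<in> ?S\<^sup>*" by (rule rtrancl_map) (rule \<phi>)
    then show "p \<in> ?S\<^sup>*" using p by (simp add: \<phi>_def)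
  qed
  have S: "tree_on U ?S"
    unfolding tree_on_def
  proof (intro conjI allI impI)
    show "sym ?S" using R'(2) by (auto simp: sym_def)
    fix u v assume "(u, v) \<in> ?S"
    moreover have "(?S - {(u, v), (v, u)})\<^sup>* \<subseteq> (R - {(u, v), (v, u)})\<^sup>*"
      by (rule rtrancl_mono) auto
    ultimately show "(u, v) \<notin> (?S - {(u, v), (v, u)})\<^sup>*" using br by blast
  qed (use connS in auto)
  obtain u where u: "u \<in> U" using ne by blast
  then have "(u, \<sigma> u) \<in> R\<^sup>*" using R'(3) by auto
  then obtain x y where xy: "(x, y) \<in> R" "x \<in> U" "y \<notin> U"
    using rtrancl_exit[of u "\<sigma> u" R U] u \<sigma>_U by auto
  have y: "y = \<sigma> x" using cr xy by blast
  have uniq: "z = x" if z: "(z, \<sigma> z) \<in> R" "z \<in> U" for z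
  proof (rule ccontr)
    assume "z \<noteq> x"
    let ?Q = "R - {(x, \<sigma> x), (\<sigma> x, x)}"
    have SQ: "?S \<subseteq> ?Q" using \<sigma>_U xy(2) by auto
    have "(x, z) \<in> ?Q\<^sup>*" using connS xy(2) z(2) rtrancl_mono[OF SQ] by auto
    moreover have "(z, \<sigma> z) \<in> ?Q" using z \<open>z \<noteq> x\<close> \<sigma>_U xy(2) by auto
    moreover have "(\<sigma> z, \<sigma> x) \<in> ?Q\<^sup>*"
    proof (rule rtrancl_map[where f = \<sigma> and R = ?S])
      show "(z, x) \<in> ?S\<^sup>*" using connS xy(2) z(2) by auto
      show "(\<sigma> a, \<sigma> b) \<in> ?Q\<^sup>*" if "(a, b) \<in> ?S" for a b
        using that \<sigma>R \<sigma>_U xy(2) by auto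
    qed
    ultimately have "(x, \<sigma> x) \<in> ?Q\<^sup>*" by (meson rtrancl.rtrancl_into_rtrancl rtrancl_trans)
    then show False using br xy y by blast
  qed
  have "R = double x ?S"
  proof
    show "double x ?S \<subseteq> R"
      using xy y R'(2) \<sigma>R unfolding double_def by (auto dest: symD)
    show "R \<subseteq> double x ?S"
    proof
      fix p assume "p \<in> R"
      then obtain u v where p: "p = (u, v)" "(u, v) \<in> R" by (cases p) auto
      consider "u \<in> U" "v \<in> U" | "u \<in> U" "v \<notin> U" | "u \<notin> U" "v \<in> U" | "u \<notin> U" "v \<notin> U" by blast
      then show "p \<in> double x ?S"
      proof cases
        case 1
        then show ?thesis using p by (auto simp: double_def)
      next
        case 2
        then show ?thesis using cr[OF p(2)] uniq p by (auto simp: double_def)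
      next
        case 3
        have "(v, u) \<in> R" using symD[OF R'(2) p(2)] .
        then show ?thesis using 3 cr uniq p by (auto simp: double_def)
      next
        case 4
        then have "\<sigma> u \<in> U" "\<sigma> v \<in> U" using R'(1) p by auto
        then have "(\<sigma> u, \<sigma> v) \<in> ?S" using \<sigma>R p by auto
        then have "map_prod \<sigma> \<sigma> (\<sigma> u, \<sigma> v) \<in> map_prod \<sigma> \<sigma> ` ?S" by (rule imageI)
        then show ?thesis using p by (simp add: double_def)
      qed
    qed
  qed
  then show ?thesis using S xy y RA by blast
qed

lemma double_invariant: "map_prod \<sigma> \<sigma> ` double x S = double x S"
  unfolding double_def by (auto simp: image_Un image_image map_prod_def case_prod_unfold)

lemma card_invariant_trees:
  assumes ne: "U \<noteq> {}"
  shows "card {R. R \<subseteq> A \<and> tree_on (U \<union> \<sigma> ` U) R \<and> map_prod \<sigma> \<sigma> ` R = R} =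
    card {x \<in> U. (x, \<sigma> x) \<in> A} * card {S. S \<subseteq> A \<inter> U \<times> U \<and> tree_on U S}"
    (is "card ?L = card ?K * card ?T")
proof -
  have "bij_betw (\<lambda>(x, S). double x S) (?K \<times> ?T) ?L"
    unfolding bij_betw_def
  proof
    show "inj_on (\<lambda>(x, S). double x S) (?K \<times> ?T)"
    proof (rule inj_onI, clarify)
      fix x S y S'
      assume a: "x \<in> U" "y \<in> U" "S \<subseteq> A \<inter> U \<times> U" "S' \<subseteq> A \<inter> U \<times> U" "double x S = double y S'"
      then have "S = S'" by (metis double_Int le_inf_iff)
      moreover have "(x, \<sigma> x) \<in> double y S'" using a(5) by (auto simp: double_def)
      then have "x = y" using double_crossing a by (metis le_inf_iff)
      ultimately show "x = y \<and> S = S'" by simp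
    qed
    show "(\<lambda>(x, S). double x S) ` (?K \<times> ?T) = ?L"
    proof
      show "(\<lambda>(x, S). double x S) ` (?K \<times> ?T) \<subseteq> ?L"
      proof clarify
        fix x S assume a: "x \<in> U" "(x, \<sigma> x) \<in> A" "S \<subseteq> A \<inter> U \<times> U" "tree_on U S"
        then have "double x S \<subseteq> A"
          using \<sigma>_A sym_A unfolding double_def by (auto dest: symD)
        then show "double x S \<subseteq> A \<and> tree_on (U \<union> \<sigma> ` U) (double x S) \<and> map_prod \<sigma> \<sigma> ` double x S = double x S"
          using tree_on_double[OF a(4,1)] double_invariant by blast
      qed
      show "?L \<subseteq> (\<lambda>(x, S). double x S) ` (?K \<times> ?T)"
      proof clarify
        fix R assume a: "R \<subseteq> A" "tree_on (U \<union> \<sigma> ` U) R" "map_prod \<sigma> \<sigma> ` R = R"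
        obtain x where x: "x \<in> U" "(x, \<sigma> x) \<in> A" "tree_on U (R \<inter> U \<times> U)" "R = double x (R \<inter> U \<times> U)"
          using invariant_tree_is_double[OF a ne] by blast
        show "R \<in> (\<lambda>(x, S). double x S) ` (?K \<times> ?T)"
          by (rule image_eqI[of _ _ "(x, R \<inter> U \<times> U)"]) (use x a(1) in auto)
      qed
    qed
  qed
  then show ?thesis by (simp add: bij_betw_same_card[symmetric] card_cartesian_product)
qed

end

section \<open>Determinants over finite index sets\<close>

text \<open>The Leibniz formula over an unordered index set: faces carry no natural numbering, and
  the expansion along rows needs none. Matrices enter only for kernels and eigenvalues.\<close>

definition det_on :: "'a set \<Rightarrow> ('a \<Rightarrow> 'a \<Rightarrow> 'b) \<Rightarrow> 'b :: comm_ring_1" where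
  "det_on F M = (\<Sum>p | p permutes F. of_int (sign p) * (\<Prod>f\<in>F. M f (p f)))"

lemma det_on_eq_det:
  fixes M :: "'a \<Rightarrow> 'a \<Rightarrow> 'b :: comm_ring_1"
  assumes e: "bij_betw e {0..<m} F"
  shows "det_on F M = det (mat m m (\<lambda>(i, j). M (e i) (e j)))"
proof -
  let ?I = "{0..<m}" and ?g = "inv_into {0..<m} e"
  have inj: "inj_on e ?I" using e by (simp add: bij_betw_def)
  have g: "bij_betw ?g F ?I" using e by (rule bij_betw_inv_into)
  have ge: "?g (e i) = i" if "i \<in> ?I" for i using inj that by (rule inv_into_f_f)
  have eg: "e (?g f) = f" if "f \<in> F" for f using e that by (metis bij_betw_inv_into_right)
  have "det_on F M = (\<Sum>p | p permutes ?I. of_int (sign p) * (\<Prod>i\<in>?I. M (e i) (e (p i))))"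
    unfolding det_on_def
  proof (rule sum.reindex_bij_witness[of _ "map_permutation ?I e" "map_permutation F ?g"])
    fix q assume "q \<in> {q. q permutes F}"
    then have q: "q permutes F" by simp
    show "map_permutation ?I e (map_permutation F ?g q) = q"
      by (rule map_permutation_compose_inv[OF g q eg])
    show "map_permutation F ?g q \<in> {p. p permutes ?I}"
      using map_permutation_permutes[OF g q] by simp
    have "finite F" using e bij_betw_finite by blast
    then have "sign (map_permutation F ?g q) = sign q"
      using g q by (intro sign_map_permutation) (auto simp: bij_betw_def)
    moreover have "(\<Prod>i\<in>?I. M (e i) (e (map_permutation F ?g q i))) = (\<Prod>f\<in>F. M f (q f))"
    proof (rule prod.reindex_bij_witness[of _ ?g e])
      fix i assume i: "i \<in> ?I"
      then have ei: "e i \<in> F" using e by (auto simp: bij_betw_def)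
      then have qe: "q (e i) \<in> F" using q by (simp add: permutes_in_image)
      have "map_permutation F ?g q (?g (e i)) = ?g (q (e i))"
        using g ei by (intro map_permutation_apply) (auto simp: bij_betw_def)
      then show "M (e i) (q (e i)) = M (e i) (e (map_permutation F ?g q i))"
        using ge[OF i] eg[OF qe] by simp
    qed (use e g ge eg in \<open>auto simp: bij_betw_def\<close>)
    ultimately show "of_int (sign (map_permutation F ?g q)) *
        (\<Prod>i\<in>?I. M (e i) (e (map_permutation F ?g q i))) =
        of_int (sign q) * (\<Prod>f\<in>F. M f (q f))" by simp
  next
    fix p assume "p \<in> {p. p permutes ?I}"
    then have p: "p permutes ?I" by simp
    show "map_permutation F ?g (map_permutation ?I e p) = p"
      by (rule map_permutation_compose_inv[OF e p ge])
    show "map_permutation ?I e p \<in> {p. p permutes F}"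
      using map_permutation_permutes[OF e p] by simp
  qed
  also have "\<dots> = det (mat m m (\<lambda>(i, j). M (e i) (e j)))"
  proof -
    have "(\<Prod>i\<in>?I. M (e i) (e (p i))) = (\<Prod>i\<in>?I. mat m m (\<lambda>(i, j). M (e i) (e j)) $$ (i, p i))"
      if p: "p permutes ?I" for p
    proof (rule prod.cong)
      fix i assume "i \<in> ?I"
      then have "i < m" "p i < m" using permutes_in_image[OF p, of i] by auto
      then show "M (e i) (e (p i)) = mat m m (\<lambda>(i, j). M (e i) (e j)) $$ (i, p i)" by simp
    qed simp
    then show ?thesis by (subst det_def'[of _ m]) auto
  qed
  finally show ?thesis .
qed

lemma det_on_sum_rows:
  fixes m :: "'a \<Rightarrow> 'd \<Rightarrow> 'a \<Rightarrow> 'b :: comm_ring_1"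
  assumes "finite F" "finite D"
  shows "det_on F (\<lambda>f g. \<Sum>d\<in>D. m f d g) = (\<Sum>c \<in> F \<rightarrow>\<^sub>E D. det_on F (\<lambda>f. m f (c f)))"
proof -
  have "(\<Prod>f\<in>F. \<Sum>d\<in>D. m f d (p f)) = (\<Sum>c \<in> F \<rightarrow>\<^sub>E D. \<Prod>f\<in>F. m f (c f) (p f))" for p
    by (rule prod_sum_PiE) (use assms in auto)
  then show ?thesis
    unfolding det_on_def sum_distrib_left by (simp only:) (subst sum.swap, simp add: sum_distrib_left)
qed

lemma det_on_null_vector:
  fixes M :: "'a \<Rightarrow> 'a \<Rightarrow> 'b :: idom"
  assumes "finite F" "h \<in> F" "v h \<noteq> 0" and null: "\<And>f. f \<in> F \<Longrightarrow> (\<Sum>g\<in>F. M f g * v g) = 0"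
  shows "det_on F M = 0"
proof -
  obtain e where e: "bij_betw e {0..<card F} F"
    using ex_bij_betw_nat_finite[OF assms(1)] by blast
  let ?m = "card F"
  let ?A = "mat ?m ?m (\<lambda>(i, j). M (e i) (e j))" and ?v = "vec ?m (v \<circ> e)"
  have eF: "e i \<in> F" if "i < ?m" for i using e that by (auto simp: bij_betw_def)
  have "h \<in> e ` {0..<?m}" using e assms(2) by (simp add: bij_betw_def)
  then obtain i where i: "i < ?m" "e i = h" by auto
  have "?v $ i \<noteq> 0" using i assms(3) by simp
  then have "?v \<noteq> 0\<^sub>v ?m" using i(1) by (metis index_zero_vec(1))
  moreover have "?A *\<^sub>v ?v = 0\<^sub>v ?m"
  proof (rule eq_vecI)
    fix i assume "i < dim_vec (0\<^sub>v ?m)"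
    then have i: "i < ?m" by simp
    have "(?A *\<^sub>v ?v) $ i = (\<Sum>j\<in>{0..<?m}. M (e i) (e j) * v (e j))"
      using i by (simp add: scalar_prod_def)
    also have "\<dots> = (\<Sum>g\<in>F. M (e i) g * v g)"
      by (rule sum.reindex_bij_betw[OF e])
    finally show "(?A *\<^sub>v ?v) $ i = 0\<^sub>v ?m $ i" using null[OF eF[OF i]] i by simp
  qed simp
  ultimately have "det ?A = 0"
    by (subst det_0_iff_vec_prod_zero[of _ ?m]) (auto intro!: exI[of _ ?v])
  then show ?thesis using det_on_eq_det[OF e] by metis
qed

text \<open>Only the first exit counts, so the property depends on \<open>s\<close> inside
  \<open>F\<close> alone; a choice of sides is meaningful only there.\<close>

definition escapes :: "'a set \<Rightarrow> ('a \<Rightarrow> 'a) \<Rightarrow> bool" where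
  "escapes F s \<longleftrightarrow> (\<forall>f\<in>F. \<exists>k. (s ^^ k) f \<notin> F)"

text \<open>A permutation with nonzero term fixes a point or moves it along \<open>s\<close>. A
  moved point would be followed by moved points forever, all in \<open>F\<close>; so if every orbit
  leaves \<open>F\<close>, only the identity contributes.\<close>

lemma det_on_functional_graph:
  fixes s :: "'a \<Rightarrow> 'a"
  assumes fin: "finite F" and ne: "\<And>f. f \<in> F \<Longrightarrow> s f \<noteq> f"
  shows "det_on F (\<lambda>f g. of_bool (f = g) - of_bool (s f = g)) = (of_bool (escapes F s) :: 'b :: idom)"
proof (cases "escapes F s")
  case True
  let ?M = "\<lambda>f g. of_bool (f = g) - of_bool (s f = g) :: 'b"
  have z: "(\<Prod>f\<in>F. ?M f (p f)) = 0" if p: "p permutes F" "p \<noteq> id" for p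
  proof (rule ccontr)
    assume "(\<Prod>f\<in>F. ?M f (p f)) \<noteq> 0"
    then have M: "?M f (p f) \<noteq> 0" if "f \<in> F" for f using that fin by (meson prod_zero)
    obtain f where f: "p f \<noteq> f" using p(2) by (auto simp: fun_eq_iff)
    then have fF: "f \<in> F" using p(1) by (meson permutes_not_in)
    have "(s ^^ k) f \<in> F \<and> p ((s ^^ k) f) \<noteq> (s ^^ k) f" for k
    proof (induction k)
      case (Suc k)
      let ?h = "(s ^^ k) f"
      have "p ?h = s ?h" using M[of ?h] Suc by (auto split: if_splits simp: of_bool_def)
      moreover have "p (p ?h) \<noteq> p ?h"
        using Suc permutes_inj[OF p(1)] by (metis injD)
      moreover have "p ?h \<in> F" using Suc p(1) by (simp add: permutes_in_image)
      ultimately show ?case by simp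
    qed (use f fF in simp)
    then show False using True fF unfolding escapes_def by blast
  qed
  have "det_on F ?M = (\<Sum>p\<in>{id}. of_int (sign p) * (\<Prod>f\<in>F. ?M f (p f)))"
    unfolding det_on_def
    by (rule sum.mono_neutral_right) (use fin z in \<open>auto simp: finite_permutations permutes_id\<close>)
  also have "\<dots> = 1" using ne by simp
  finally show ?thesis using True by simp
next
  case False
  then obtain h where h: "h \<in> F" "\<And>k. (s ^^ k) h \<in> F" unfolding escapes_def by blast
  \<comment> \<open>The indicator of the points that never leave \<open>F\<close> is in the kernel.\<close>
  define U where "U = {f\<in>F. \<forall>k. (s ^^ k) f \<in> F}"
  have hU: "h \<in> U" using h by (simp add: U_def)
  have U: "f \<in> U \<longleftrightarrow> s f \<in> U" if "f \<in> F" for f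
  proof
    assume "f \<in> U"
    then have "(s ^^ Suc k) f \<in> F" for k unfolding U_def by blast
    then have "(s ^^ k) (s f) \<in> F" for k by (simp add: funpow_swap1)
    from this this[of 0] show "s f \<in> U" unfolding U_def by auto
  next
    assume "s f \<in> U"
    then have *: "(s ^^ k) (s f) \<in> F" for k unfolding U_def by blast
    have "(s ^^ k) f \<in> F" for k
      using that *[of "k - 1"] by (cases k) (auto simp: funpow_swap1)
    then show "f \<in> U" using that unfolding U_def by blast
  qed
  have "det_on F (\<lambda>f g. of_bool (f = g) - of_bool (s f = g)) = (0 :: 'b)"
  proof (rule det_on_null_vector[OF fin h(1), of "\<lambda>f. of_bool (f \<in> U)"])
    show "of_bool (h \<in> U) \<noteq> (0 :: 'b)" using hU by simp
    fix f assume f: "f \<in> F"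
    have "(\<Sum>g\<in>F. (of_bool (f = g) - of_bool (s f = g)) * of_bool (g \<in> U) :: 'b) =
        (\<Sum>g\<in>F. if g = f then of_bool (g \<in> U) else 0) - (\<Sum>g\<in>F. if g = s f then of_bool (g \<in> U) else 0)"
      unfolding sum_subtractf[symmetric] by (rule sum.cong) auto
    also have "\<dots> = of_bool (f \<in> U) - of_bool (s f \<in> U)"
      using fin f U_def by (auto simp: sum.delta)
    also have "\<dots> = 0" using U[OF f] by simp
    finally show "(\<Sum>g\<in>F. (of_bool (f = g) - of_bool (s f = g)) * of_bool (g \<in> U) :: 'b) = 0" .
  qed
  then show ?thesis using False by simp
qed

text \<open>Row \<open>f\<close> has one summand for each side \<open>d\<close>; expanding all rows
  yields one determinant for each choice \<open>c\<close>, worth 1 or 0. The matrix is a Laplacian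
  with the outside removed, so this is a form of the matrix-tree theorem.\<close>

lemma det_on_count_escaping:
  fixes t :: "'a \<Rightarrow> 'd \<Rightarrow> 'a"
  assumes "finite F" "finite D" and ne: "\<And>f d. f \<in> F \<Longrightarrow> d \<in> D \<Longrightarrow> t f d \<noteq> f"
  shows "det_on F (\<lambda>f g. \<Sum>d\<in>D. of_bool (f = g) - of_bool (t f d = g)) =
    (of_nat (card {c \<in> F \<rightarrow>\<^sub>E D. escapes F (\<lambda>f. t f (c f))}) :: 'b :: idom)"
proof -
  have "det_on F (\<lambda>f g. \<Sum>d\<in>D. of_bool (f = g) - of_bool (t f d = g)) =
      (\<Sum>c \<in> F \<rightarrow>\<^sub>E D. det_on F (\<lambda>f g. of_bool (f = g) - of_bool (t f (c f) = g)) :: 'b)"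
    by (rule det_on_sum_rows[OF assms(1,2)])
  also have "\<dots> = (\<Sum>c \<in> F \<rightarrow>\<^sub>E D. of_bool (escapes F (\<lambda>f. t f (c f))))"
  proof (rule sum.cong)
    fix c assume "c \<in> F \<rightarrow>\<^sub>E D"
    then have "t f (c f) \<noteq> f" if "f \<in> F" for f using ne that by auto
    then show "det_on F (\<lambda>f g. of_bool (f = g) - of_bool (t f (c f) = g)) =
        (of_bool (escapes F (\<lambda>f. t f (c f))) :: 'b)"
      by (rule det_on_functional_graph[OF assms(1)])
  qed simp
  also have "\<dots> = of_nat (card {c \<in> F \<rightarrow>\<^sub>E D. escapes F (\<lambda>f. t f (c f))})"
  proof -
    have "finite (F \<rightarrow>\<^sub>E D)" using assms by (simp add: finite_PiE)
    then show ?thesis by (simp add: sum.If_cases of_bool_def Int_def)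
  qed
  finally show ?thesis .
qed

text \<open>Orthogonality is summed over the modes, at pairs of points: it says
  \<open>S S^T = C I\<close> for the matrix \<open>S\<close> of eigenvectors, so \<open>S\<close> is
  invertible and the modes are complete even where eigenvalues coincide.\<close>

lemma det_on_eigen:
  fixes M :: "'a \<Rightarrow> 'a \<Rightarrow> 'b :: field" and v :: "'j \<Rightarrow> 'a \<Rightarrow> 'b"
  assumes fin: "finite F" "finite J" and card: "card F = card J"
    and eig: "\<And>j f. j \<in> J \<Longrightarrow> f \<in> F \<Longrightarrow> (\<Sum>g\<in>F. M f g * v j g) = \<mu> j * v j f"
    and orth: "\<And>f g. f \<in> F \<Longrightarrow> g \<in> F \<Longrightarrow> (\<Sum>j\<in>J. v j f * v j g) = (if f = g then C else 0)"
    and "C \<noteq> 0"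
  shows "det_on F M = (\<Prod>j\<in>J. \<mu> j)"
proof -
  let ?m = "card F"
  obtain e where e: "bij_betw e {0..<?m} F"
    using ex_bij_betw_nat_finite[OF fin(1)] by blast
  obtain d where d: "bij_betw d {0..<?m} J"
    using ex_bij_betw_nat_finite[OF fin(2)] card by auto
  have eF: "e i \<in> F" if "i < ?m" for i using e that by (auto simp: bij_betw_def)
  have dJ: "d i \<in> J" if "i < ?m" for i using d that by (auto simp: bij_betw_def)
  define A where "A = mat ?m ?m (\<lambda>(i, j). M (e i) (e j))"
  define S where "S = mat ?m ?m (\<lambda>(i, j). v (d j) (e i))"
  define L where "L = mat ?m ?m (\<lambda>(i, j). if i = j then \<mu> (d j) else 0)"
  have car: "A \<in> carrier_mat ?m ?m" "S \<in> carrier_mat ?m ?m" "L \<in> carrier_mat ?m ?m"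
    by (auto simp: A_def S_def L_def)
  have AS: "A * S = S * L"
  proof (rule eq_matI)
    fix i j assume "i < dim_row (S * L)" "j < dim_col (S * L)"
    then have ij: "i < ?m" "j < ?m" using car by auto
    have "(A * S) $$ (i, j) = (\<Sum>k\<in>{0..<?m}. M (e i) (e k) * v (d j) (e k))"
      using ij unfolding A_def S_def by (simp add: scalar_prod_def)
    also have "\<dots> = (\<Sum>g\<in>F. M (e i) g * v (d j) g)"
      by (rule sum.reindex_bij_betw[OF e])
    also have "\<dots> = \<mu> (d j) * v (d j) (e i)" using eig dJ eF ij by blast
    also have "\<dots> = (\<Sum>k\<in>{0..<?m}. v (d k) (e i) * (if k = j then \<mu> (d j) else 0))"
      using ij by (simp add: if_distrib[of "\<lambda>x. v _ _ * x"] cong: if_cong)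
    also have "\<dots> = (S * L) $$ (i, j)"
      using ij unfolding S_def L_def by (simp add: scalar_prod_def)
    finally show "(A * S) $$ (i, j) = (S * L) $$ (i, j)" .
  qed (use car in auto)
  have SS: "S * transpose_mat S = C \<cdot>\<^sub>m 1\<^sub>m ?m"
  proof (rule eq_matI)
    fix i j assume "i < dim_row (C \<cdot>\<^sub>m 1\<^sub>m ?m)" "j < dim_col (C \<cdot>\<^sub>m 1\<^sub>m ?m)"
    then have ij: "i < ?m" "j < ?m" by auto
    have "(S * transpose_mat S) $$ (i, j) = (\<Sum>k\<in>{0..<?m}. v (d k) (e i) * v (d k) (e j))"
      using ij unfolding S_def by (simp add: scalar_prod_def)
    also have "\<dots> = (\<Sum>k\<in>J. v k (e i) * v k (e j))"
      by (rule sum.reindex_bij_betw[OF d])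
    also have "\<dots> = (if e i = e j then C else 0)" using orth eF ij by blast
    also have "e i = e j \<longleftrightarrow> i = j" using e ij by (auto simp: bij_betw_def inj_on_def)
    finally show "(S * transpose_mat S) $$ (i, j) = (C \<cdot>\<^sub>m 1\<^sub>m ?m) $$ (i, j)" using ij by simp
  qed (use car in auto)
  have "det S * det S = det (S * transpose_mat S)"
    using car by (simp add: det_mult[of _ ?m] det_transpose)
  also have "\<dots> = C ^ ?m" unfolding SS by simp
  finally have "det S \<noteq> 0" using \<open>C \<noteq> 0\<close> by auto
  moreover have "det A * det S = det S * det L"
    using AS car by (metis det_mult)
  ultimately have "det A = det L" by simp
  also have "det L = prod_list (diag_mat L)"
    by (rule det_upper_triangular[OF _ car(3)]) (auto simp: L_def)
  also have "\<dots> = (\<Prod>k\<in>{0..<?m}. \<mu> (d k))"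
    unfolding prod_list_diag_prod by (simp add: L_def)
  also have "\<dots> = (\<Prod>j\<in>J. \<mu> j)" by (rule prod.reindex_bij_betw[OF d])
  finally show ?thesis using det_on_eq_det[OF e] A_def by metis
qed

section \<open>Planar duality on the half board\<close>

text \<open>
  \<open>V\<close> consists of the black squares on or above the diagonal and \<open>F\<close> of the white squares all four of whose
  side neighbours lie in \<open>V\<close>; the latter stand for the bounded faces.  An edge of the graph joins the two
  black squares meeting at a lattice point, its dual edge joins the two white squares meeting there,
  and \<open>E\<close> is the set of these lattice points.
\<close>

locale half_board =
  fixes n :: int
  assumes n_pos: "n \<ge> 1"
begin

definition V :: "(int \<times> int) set" where
  "V = {(i, j). 0 \<le> i \<and> i \<le> j \<and> j < 2 * n \<and> even (i + j)}"

definition A :: "((int \<times> int) \<times> (int \<times> int)) set" where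
  "A = {((i, j), (i', j')). (i, j) \<in> V \<and> (i', j') \<in> V \<and> \<bar>i - i'\<bar> = 1 \<and> \<bar>j - j'\<bar> = 1}"

definition E :: "(int \<times> int) set" where
  "E = {(a, b). 1 \<le> a \<and> a \<le> b \<and> b \<le> 2 * n - 1}"

definition F :: "(int \<times> int) set" where
  "F = {(p, q). 1 \<le> p \<and> p < q \<and> q \<le> 2 * n - 2 \<and> odd (p + q)}"

definition mid :: "(int \<times> int) \<times> (int \<times> int) \<Rightarrow> int \<times> int" where
  "mid = (\<lambda>((i, j), (i', j')). (max i i', max j j'))"

text \<open>Of the four squares around a lattice point, parity decides which diagonal pair is black.
  One of the two directions of the edge is singled out.\<close>

definition arc :: "int \<times> int \<Rightarrow> (int \<times> int) \<times> (int \<times> int)" where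
  "arc = (\<lambda>(a, b). if even (a + b) then ((a - 1, b - 1), (a, b)) else ((a - 1, b), (a, b - 1)))"

text \<open>The face of a white square is bounded by the four edges through its corners, so a
  direction names both a side of the face and the face beyond it. The Booleans stand for right and
  up.\<close>

definition corner :: "int \<times> int \<Rightarrow> bool \<times> bool \<Rightarrow> int \<times> int" where
  "corner = (\<lambda>(p, q) (x, y). (if x then p + 1 else p, if y then q + 1 else q))"

definition opposite :: "int \<times> int \<Rightarrow> bool \<times> bool \<Rightarrow> int \<times> int" where
  "opposite = (\<lambda>(p, q) (x, y). (if x then p + 1 else p - 1, if y then q + 1 else q - 1))"

definition crossed :: "(int \<times> int \<Rightarrow> bool \<times> bool) \<Rightarrow> (int \<times> int) set" where
  "crossed c = (\<lambda>f. corner f (c f)) ` F"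

definition uncrossed :: "(int \<times> int \<Rightarrow> bool \<times> bool) \<Rightarrow> ((int \<times> int) \<times> (int \<times> int)) set" where
  "uncrossed c = {x \<in> A. mid x \<notin> crossed c}"

abbreviation step :: "(int \<times> int \<Rightarrow> bool \<times> bool) \<Rightarrow> int \<times> int \<Rightarrow> int \<times> int" where
  "step c f \<equiv> opposite f (c f)"

lemma finite_V: "finite V"
  by (rule finite_subset[of _ "{0..2 * n} \<times> {0..2 * n}"]) (auto simp: V_def)

lemma finite_E: "finite E"
  by (rule finite_subset[of _ "{0..2 * n} \<times> {0..2 * n}"]) (auto simp: E_def)

lemma finite_F: "finite F"
  by (rule finite_subset[of _ "{0..2 * n} \<times> {0..2 * n}"]) (auto simp: F_def)

lemma A_subset: "A \<subseteq> V \<times> V"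
  by (auto simp: A_def)

lemma sym_A: "sym A"
  by (auto simp: A_def sym_def)

lemma mid_arc [simp]: "mid (arc e) = e" "mid (prod.swap (arc e)) = e"
  by (auto simp: mid_def arc_def split: prod.splits)

lemma arc_in_A:
  assumes "e \<in> E"
  shows "arc e \<in> A"
proof -
  obtain a b where e: "e = (a, b)" by fastforce
  have ab: "1 \<le> a" "a \<le> b" "b \<le> 2 * n - 1" using assms e by (auto simp: E_def)
  show ?thesis
  proof (cases "even (a + b)")
    case False
    \<comment> \<open>Off the diagonal, the lower right square at the lattice point still lies on or
      above the diagonal of the board.\<close>
    then have "a \<noteq> b" by auto
    then show ?thesis using False ab by (simp add: e arc_def A_def V_def)
  qed (use ab in \<open>simp add: e arc_def A_def V_def\<close>)
qed

lemma swap_A: "prod.swap x \<in> A \<longleftrightarrow> x \<in> A"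
  using sym_A by (cases x) (auto dest: symD)

lemma A_cases:
  assumes "x \<in> A"
  shows "x = arc (mid x) \<or> x = prod.swap (arc (mid x))"
proof -
  obtain i j i' j' where x: "x = ((i, j), (i', j'))" by (metis prod.exhaust)
  have e: "even (i + j)" "even (i' + j')" and d: "\<bar>i - i'\<bar> = 1" "\<bar>j - j'\<bar> = 1"
    using assms x by (auto simp: A_def V_def)
  from d have "i' = i + 1 \<or> i' = i - 1" "j' = j + 1 \<or> j' = j - 1" by auto
  then show ?thesis using e unfolding x by (auto simp: mid_def arc_def max_def)
qed

lemma mid_in_E:
  assumes "x \<in> A"
  shows "mid x \<in> E"
proof -
  obtain i j i' j' where x: "x = ((i, j), (i', j'))" by (metis prod.exhaust)
  have e: "0 \<le> i" "i \<le> j" "j < 2 * n" "0 \<le> i'" "i' \<le> j'" "j' < 2 * n"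
    "\<bar>i - i'\<bar> = 1" "\<bar>j - j'\<bar> = 1"
    using assms x by (auto simp: A_def V_def)
  then show ?thesis unfolding x by (auto simp: mid_def E_def)
qed

lemma card_arcs:
  assumes "X \<subseteq> E"
  shows "card {x \<in> A. mid x \<in> X} = 2 * card X"
proof -
  have eq: "{x \<in> A. mid x \<in> X} = arc ` X \<union> (prod.swap \<circ> arc) ` X"
  proof
    show "{x \<in> A. mid x \<in> X} \<subseteq> arc ` X \<union> (prod.swap \<circ> arc) ` X"
      using A_cases by (fastforce simp: image_iff)
    show "arc ` X \<union> (prod.swap \<circ> arc) ` X \<subseteq> {x \<in> A. mid x \<in> X}"
    proof
      fix x assume "x \<in> arc ` X \<union> (prod.swap \<circ> arc) ` X"
      then obtain e where e: "e \<in> X" "x = arc e \<or> x = prod.swap (arc e)" by auto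
      have "arc e \<in> A" using arc_in_A e(1) assms by blast
      then show "x \<in> {x \<in> A. mid x \<in> X}"
        using e by (elim disjE) (simp_all add: swap_A)
    qed
  qed
  have fin: "finite X" using assms finite_E by (rule finite_subset)
  have "inj_on arc X" "inj_on (prod.swap \<circ> arc) X"
    by (metis mid_arc(1) inj_onI) (metis mid_arc(2) comp_apply inj_onI)
  then have "card (arc ` X) = card X" "card ((prod.swap \<circ> arc) ` X) = card X"
    by (simp_all only: card_image)
  moreover have "arc ` X \<inter> (prod.swap \<circ> arc) ` X = {}"
  proof -
    have "arc e \<noteq> prod.swap (arc e')" for e e'
      by (auto simp: arc_def split: prod.splits if_splits)
    then show ?thesis unfolding disjoint_iff image_iff comp_apply by metis
  qed
  ultimately show ?thesis
    unfolding eq using fin by (simp add: card_Un_disjoint)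
qed

text \<open>
  Name a lattice point by the square to its upper right.  Then \<open>E\<close> consists of \<open>F\<close>, of the black squares
  outside column 0, and of one further point \<open>(j, 2 n - 1)\<close> for each \<open>(0, j)\<close> in \<open>V\<close> with \<open>j \<noteq> 0\<close>.
\<close>

lemma euler: "card V + card F = card E + 1"
proof -
  let ?V1 = "{(i, j). 1 \<le> i \<and> i \<le> j \<and> j < 2 * n \<and> even (i + j)}"
  let ?Z = "{j. even j \<and> 1 \<le> j \<and> j \<le> 2 * n - 1}"
  have fin: "finite ?V1" "finite ?Z"
    by (rule finite_subset[OF _ finite_V]) (auto simp: V_def intro: finite_subset[of _ "{0..2 * n}"])
  have V: "V = ?V1 \<union> Pair 0 ` (insert 0 ?Z)"
    using n_pos by (auto simp: V_def image_iff) presburger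
  have E: "E = ?V1 \<union> F \<union> (\<lambda>j. (j, 2 * n - 1)) ` ?Z"
    using n_pos by (auto simp: E_def F_def image_iff)
  have "card V = card ?V1 + card (insert 0 ?Z)"
  proof -
    have "card (Pair 0 ` insert 0 ?Z) = card (insert 0 ?Z)"
      by (rule card_image) (simp add: inj_on_def)
    moreover have "?V1 \<inter> Pair 0 ` insert 0 ?Z = {}" by auto
    ultimately show ?thesis
      unfolding V using fin card_Un_disjoint[of ?V1 "Pair 0 ` insert 0 ?Z"] by simp
  qed
  moreover have "card (insert 0 ?Z) = Suc (card ?Z)"
    using fin by (subst card_insert_disjoint) auto
  moreover have "card E = card ?V1 + card F + card ?Z"
  proof -
    have "card ((\<lambda>j. (j, 2 * n - 1)) ` ?Z) = card ?Z"
      by (rule card_image) (simp add: inj_on_def)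
    moreover have "(?V1 \<union> F) \<inter> (\<lambda>j. (j, 2 * n - 1)) ` ?Z = {}" "?V1 \<inter> F = {}"
      by (auto simp: F_def)
    ultimately show ?thesis unfolding E using fin finite_F by (simp add: card_Un_disjoint)
  qed
  ultimately show ?thesis by simp
qed

lemma V_ne: "V \<noteq> {}"
proof -
  have "(0, 0) \<in> V" using n_pos by (simp add: V_def)
  then show ?thesis by blast
qed

text \<open>Every square walks to the origin, down-left while possible and down-right from column
  0.\<close>

lemma connected_A: "V \<times> V \<subseteq> A\<^sup>*"
proof -
  have 0: "((i, j), (0, 0)) \<in> A\<^sup>*" if "(i, j) \<in> V" for i j
    using that
  \<comment> \<open>Both moves lower this weight, by 3 and by 1; \<open>i + j\<close> would not
    change in the second.\<close>
  proof (induction "nat (i + 2 * j)" arbitrary: i j rule: less_induct)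
    case less
    have "0 \<le> i" "i \<le> j" "even (i + j)" using less.prems by (auto simp: V_def)
    then have "1 \<le> i \<or> i = 0 \<and> j \<ge> 2 \<or> i = 0 \<and> j = 0" by presburger
    then consider "1 \<le> i" | "i = 0" "j \<ge> 2" | "i = 0" "j = 0" by blast
    then show ?case
    proof cases
      case 1
      then have "((i, j), (i - 1, j - 1)) \<in> A" "(i - 1, j - 1) \<in> V"
        using less.prems by (auto simp: V_def A_def)
      moreover have "nat (i - 1 + 2 * (j - 1)) < nat (i + 2 * j)" using 1 less.prems by (auto simp: V_def)
      ultimately show ?thesis using less.hyps by (meson converse_rtrancl_into_rtrancl)
    next
      case 2
      then have "((i, j), (i + 1, j - 1)) \<in> A" "(i + 1, j - 1) \<in> V"
        using less.prems by (auto simp: V_def A_def)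
      moreover have "nat (i + 1 + 2 * (j - 1)) < nat (i + 2 * j)" using 2 less.prems by (auto simp: V_def)
      ultimately show ?thesis using less.hyps by (meson converse_rtrancl_into_rtrancl)
    qed simp
  qed
  then have "((0, 0), (i, j)) \<in> A\<^sup>*" if "(i, j) \<in> V" for i j
    using that symD[OF sym_rtrancl[OF sym_A]] by blast
  then show ?thesis using 0 by (auto intro: rtrancl_trans[OF 0])
qed

section \<open>Sides of faces and choices of sides\<close>

lemma opposite_ne: "opposite f d \<noteq> f"
  by (auto simp: opposite_def split: prod.splits)

lemma corner_inj: "corner f d = corner f d' \<longleftrightarrow> d = d'"
  by (auto simp: corner_def split: prod.splits if_splits)

lemma corner_in_E: "f \<in> F \<Longrightarrow> corner f d \<in> E"
  by (cases d) (auto simp: corner_def E_def F_def)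

lemma corner_opposite: "corner (opposite f (x, y)) (\<not> x, \<not> y) = corner f (x, y)"
  by (auto simp: corner_def opposite_def split: prod.splits)

lemma opposite_opposite: "opposite (opposite f (x, y)) (\<not> x, \<not> y) = f"
  by (auto simp: opposite_def split: prod.splits)

text \<open>Only two of the four squares around a lattice point are white, and they lie diagonally
  opposite.\<close>

lemma corner_eqD:
  assumes "f \<in> F" "g \<in> F" "corner f d = corner g e" "f \<noteq> g"
  shows "g = opposite f d"
proof -
  obtain p q r s x y x' y' where *: "f = (p, q)" "g = (r, s)" "d = (x, y)" "e = (x', y')"
    by (metis prod.exhaust)
  have "odd (p + q)" "odd (r + s)" using assms(1,2) by (auto simp: * F_def)
  then show ?thesis
    using assms(3,4) by (cases x; cases y; cases x'; cases y') (auto simp: * corner_def opposite_def)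
qed

text \<open>A cycle of steps inside \<open>F\<close> would never leave it. In this order the
  predecessors of a face are the faces pointing to it, as the rerouting of crossed edges
  requires.\<close>

lemma escapes_wf:
  assumes "escapes F s"
  shows "wf {(g, f). g \<in> F \<and> f \<in> F \<and> s g = f}"
proof (rule finite_acyclic_wf)
  let ?r = "{(g, f). g \<in> F \<and> f \<in> F \<and> s g = f}"
  show "finite ?r"
    by (rule finite_subset[of _ "F \<times> F"]) (use finite_F in auto)
  have pow: "\<exists>k>0. (s ^^ k) g = f" if "(g, f) \<in> ?r\<^sup>+" for f g
    using that
  proof induction
    case (base y)
    then show ?case by (intro exI[of _ 1]) auto
  next
    case (step y z)
    then obtain k where "(s ^^ k) g = y" by blast
    then show ?case using step by (intro exI[of _ "Suc k"]) auto
  qed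
  show "acyclic ?r"
  proof (rule acyclicI, rule allI, rule notI)
    fix f assume ff: "(f, f) \<in> ?r\<^sup>+"
    have inv: "(s ^^ k) f \<in> F \<and> ((s ^^ k) f, (s ^^ k) f) \<in> ?r\<^sup>+" for k
    proof (induction k)
      case 0
      have "f \<in> F" using ff by (induction rule: trancl_induct) auto
      then show ?case using ff by simp
    next
      case (Suc k)
      let ?h = "(s ^^ k) f"
      from Suc obtain g where g: "(?h, g) \<in> ?r" "(g, ?h) \<in> ?r\<^sup>*"
        by (meson tranclD)
      then have "g = s ?h" "g \<in> F" by auto
      moreover have "(g, g) \<in> ?r\<^sup>+" using g by (meson rtrancl_into_trancl1)
      ultimately show ?case by simp
    qed
    then show False using assms unfolding escapes_def by (metis funpow_0)
  qed
qed

text \<open>Two faces choosing the same edge point to each other and are caught in a cycle of length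
  two.\<close>

lemma crossing_inj:
  assumes "escapes F (step c)"
  shows "inj_on (\<lambda>f. corner f (c f)) F"
proof (rule inj_onI, rule ccontr)
  fix f g assume fg: "f \<in> F" "g \<in> F" "corner f (c f) = corner g (c g)" "f \<noteq> g"
  then have "step c f = g" "step c g = f"
    using corner_eqD[of f g "c f" "c g"] corner_eqD[of g f "c g" "c f"] by metis+
  then have "((step c) ^^ k) f \<in> {f, g}" for k
    by (induction k) auto
  moreover have "{f, g} \<subseteq> F" using fg(1,2) by simp
  ultimately have "((step c) ^^ k) f \<in> F" for k by (rule subsetD[rotated])
  then show False using assms fg(1) unfolding escapes_def by blast
qed

lemma crossed_subset: "crossed c \<subseteq> E"
  unfolding crossed_def using corner_in_E by blast

lemma card_crossed: "escapes F (step c) \<Longrightarrow> card (crossed c) = card F"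
  unfolding crossed_def by (rule card_image) (rule crossing_inj)

lemma uncrossed_eq: "uncrossed c = {x \<in> A. mid x \<in> E - crossed c}"
  using mid_in_E by (auto simp: uncrossed_def)

lemma sym_uncrossed: "sym (uncrossed c)"
proof -
  have "mid (u, v) = mid (v, u)" for u v
    by (auto simp: mid_def split: prod.splits)
  then show ?thesis using sym_A by (auto simp: uncrossed_def sym_def)
qed

text \<open>
  A crossed edge can be replaced by the other three sides of the face that crosses it.  Those of them
  that are crossed too are crossed from a neighbour pointing to this face, whence the induction.
\<close>

lemma arc_uncrossed:
  assumes e: "escapes F (step c)" and f: "f \<in> F"
  shows "arc (corner f (c f)) \<in> (uncrossed c)\<^sup>*"
  using f
proof (induction f rule: wf_induct_rule[OF escapes_wf[OF e]])
  case (1 f)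
  let ?R = "uncrossed c"
  have other: "arc (corner f d) \<in> ?R\<^sup>*" if d: "d \<noteq> c f" for d
  proof (cases "corner f d \<in> crossed c")
    case False
    then have "arc (corner f d) \<in> ?R"
      using arc_in_A[OF corner_in_E[OF 1(2)]] by (simp add: uncrossed_def)
    then show ?thesis by (cases "arc (corner f d)") auto
  next
    case True
    then obtain g where g: "g \<in> F" "corner f d = corner g (c g)"
      by (auto simp: crossed_def)
    then have "f \<noteq> g" using d corner_inj by metis
    then have "f = step c g" using corner_eqD[OF g(1) 1(2)] g(2) by metis
    then have "arc (corner g (c g)) \<in> ?R\<^sup>*" using 1 g(1) by auto
    then show ?thesis using g(2) by simp
  qed
  obtain p q where f: "f = (p, q)" by fastforce
  have odd: "odd (p + q)" using 1(2) f by (simp add: F_def)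
  have sym: "(u, v) \<in> ?R\<^sup>* \<Longrightarrow> (v, u) \<in> ?R\<^sup>*" for u v
    using symD[OF sym_rtrancl[OF sym_uncrossed]] .
  have arcs: "arc (corner f (False, False)) = ((p - 1, q), (p, q - 1))"
    "arc (corner f (True, False)) = ((p, q - 1), (p + 1, q))"
    "arc (corner f (False, True)) = ((p - 1, q), (p, q + 1))"
    "arc (corner f (True, True)) = ((p, q + 1), (p + 1, q))"
    using odd by (auto simp: f arc_def corner_def)
  show ?case
    using other[of "(False, False)"] other[of "(True, False)"] other[of "(False, True)"]
      other[of "(True, True)"]
    by (cases "c f"; cases "fst (c f)"; cases "snd (c f)")
      (auto simp: arcs dest: sym intro: rtrancl_trans)
qed

text \<open>Rerouting around crossed edges keeps \<open>V\<close> connected, and one edge is lost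
  for each face; Euler's formula turns \<open>|E| - |F|\<close> into \<open>|V| - 1\<close>.\<close>

lemma tree_on_uncrossed:
  assumes "escapes F (step c)"
  shows "tree_on V (uncrossed c)"
proof (rule tree_onI_card)
  let ?R = "uncrossed c"
  show "?R \<subseteq> V \<times> V" using A_subset by (auto simp: uncrossed_def)
  show "sym ?R" by (rule sym_uncrossed)
  have "x \<in> ?R\<^sup>*" if x: "x \<in> A" for x
  proof (cases "mid x \<in> crossed c")
    case False
    then show ?thesis using x by (cases x) (auto simp: uncrossed_def)
  next
    case True
    then obtain f where f: "f \<in> F" "mid x = corner f (c f)" by (auto simp: crossed_def)
    then have *: "arc (mid x) \<in> ?R\<^sup>*" using arc_uncrossed[OF assms] by simp
    moreover have "prod.swap (arc (mid x)) \<in> ?R\<^sup>*"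
      using * symD[OF sym_rtrancl[OF sym_uncrossed]] by (cases "arc (mid x)") auto
    ultimately show ?thesis using A_cases[OF x] by auto
  qed
  then have "A\<^sup>* \<subseteq> ?R\<^sup>*" by (intro rtrancl_subset_rtrancl) auto
  then show "V \<times> V \<subseteq> ?R\<^sup>*" using connected_A by blast
  have "card ?R = 2 * card (E - crossed c)"
    unfolding uncrossed_eq by (rule card_arcs) auto
  also have "card (E - crossed c) = card E - card F"
    using card_crossed[OF assms] crossed_subset[of c] finite_E
    by (simp add: card_Diff_subset finite_subset)
  finally show "card ?R = 2 * (card V - 1)" using euler by linarith
qed (rule finite_V)

text \<open>
  If two choices with the same crossed edges differ at a face, then they differ at the face it points
  to, and so on forever inside \<open>F\<close>.
\<close>

lemma inj_uncrossed:
  assumes c: "escapes F (step c)" and c': "escapes F (step c')" and eq: "uncrossed c = uncrossed c'"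
    and f: "f \<in> F"
  shows "c f = c' f"
proof (rule ccontr)
  assume ne: "c f \<noteq> c' f"
  have crossed_eq: "crossed b = E - mid ` uncrossed b" for b
  proof
    show "crossed b \<subseteq> E - mid ` uncrossed b"
      using crossed_subset by (auto simp: uncrossed_def)
    show "E - mid ` uncrossed b \<subseteq> crossed b"
    proof
      fix e assume e: "e \<in> E - mid ` uncrossed b"
      then have "arc e \<notin> uncrossed b" by (metis DiffD2 imageI mid_arc(1))
      then show "e \<in> crossed b" using e arc_in_A by (simp add: uncrossed_def)
    qed
  qed
  then have cc: "crossed c = crossed c'" using eq by metis
  have "((step c) ^^ k) f \<in> F \<and> c (((step c) ^^ k) f) \<noteq> c' (((step c) ^^ k) f)" for k
  proof (induction k)
    case (Suc k)
    let ?h = "((step c) ^^ k) f"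
    have h: "?h \<in> F" "c ?h \<noteq> c' ?h" using Suc by auto
    have "corner ?h (c ?h) \<in> crossed c'" using h(1) cc by (auto simp: crossed_def)
    then obtain g where g: "g \<in> F" "corner ?h (c ?h) = corner g (c' g)" by (auto simp: crossed_def)
    have "?h \<noteq> g" using g(2) h(2) corner_inj by metis
    then have "g = step c ?h" using corner_eqD h(1) g by blast
    moreover have "c g \<noteq> c' g"
      using g h(1) \<open>?h \<noteq> g\<close> crossing_inj[OF c] by (metis inj_onD)
    ultimately show ?case using g(1) by simp
  qed (use f ne in simp)
  then show False using c f unfolding escapes_def by blast
qed

section \<open>From a tree back to its choice of sides\<close>

lemma arc_in_tree:
  assumes "R \<subseteq> A" "sym R" "e \<in> mid ` R"
  shows "arc e \<in> R"
proof -
  obtain x where x: "x \<in> R" "mid x = e" using assms(3) by auto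
  then have "x = arc e \<or> x = prod.swap (arc e)" using A_cases assms(1) by blast
  then show ?thesis
  proof
    assume "x = prod.swap (arc e)"
    then show ?thesis using x(1) symD[OF assms(2), of "snd (arc e)" "fst (arc e)"]
      by (cases "arc e") simp
  qed (use x in simp)
qed

lemma tree_eq:
  assumes "R \<subseteq> A" "sym R"
  shows "R = {x \<in> A. mid x \<in> mid ` R}"
proof
  show "{x \<in> A. mid x \<in> mid ` R} \<subseteq> R"
  proof
    fix x assume x: "x \<in> {x \<in> A. mid x \<in> mid ` R}"
    then have "arc (mid x) \<in> R" using arc_in_tree[OF assms] by blast
    moreover from this have "prod.swap (arc (mid x)) \<in> R"
      using symD[OF assms(2)] by (cases "arc (mid x)") auto
    ultimately show "x \<in> R" using A_cases[of x] x by auto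
  qed
qed (use assms in auto)

text \<open>Going once round a square, one changes between \<open>B\<close> and its complement an
  even number of times.\<close>

lemma even_boundary_crossings:
  assumes "g \<in> F"
  shows "even (card {d. (fst (arc (corner g d)) \<in> B) \<noteq> (snd (arc (corner g d)) \<in> B)})"
proof -
  obtain p q where g: "g = (p, q)" by fastforce
  have odd: "odd (p + q)" using assms g by (simp add: F_def)
  have arcs: "arc (corner g (False, False)) = ((p - 1, q), (p, q - 1))"
    "arc (corner g (True, False)) = ((p, q - 1), (p + 1, q))"
    "arc (corner g (False, True)) = ((p - 1, q), (p, q + 1))"
    "arc (corner g (True, True)) = ((p, q + 1), (p + 1, q))"
    using odd by (auto simp: g arc_def corner_def)
  have c: "card {d. P d} = of_bool (P (False, False)) + of_bool (P (True, False)) +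
      of_bool (P (False, True)) + of_bool (P (True, True))" for P :: "bool \<times> bool \<Rightarrow> bool"
  proof -
    have "card {d. P d} = (\<Sum>d\<in>UNIV. of_bool (P d))"
      by (simp add: of_bool_def sum.If_cases)
    also have "(UNIV :: (bool \<times> bool) set) = {(False, False), (True, False), (False, True), (True, True)}"
      by (auto simp: UNIV_bool)
    finally show ?thesis by simp
  qed
  show ?thesis
    unfolding c arcs fst_conv snd_conv
    by (cases "(p - 1, q) \<in> B"; cases "(p + 1, q) \<in> B"; cases "(p, q - 1) \<in> B"; cases "(p, q + 1) \<in> B") simp_all
qed

text \<open>
  The boundary of \<open>U\<close> would be a cycle-space element contained in the tree \<open>R\<close>.  It meets the cut
  given by deleting one of its edges from \<open>R\<close> in that edge only, but a cut meets the boundary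
  of every square evenly.
\<close>

lemma no_trapped_faces:
  assumes RA: "R \<subseteq> A" and R: "tree_on V R" and UF: "U \<subseteq> F"
    and closed: "\<And>g d. g \<in> U \<Longrightarrow> corner g d \<notin> mid ` R \<Longrightarrow> opposite g d \<in> U"
  shows "U = {}"
proof (rule ccontr)
  assume "U \<noteq> {}"
  have finU: "finite U" using UF finite_F by (rule finite_subset)
  have sR: "sym R" and br: "\<And>u v. (u, v) \<in> R \<Longrightarrow> (u, v) \<notin> (R - {(u, v), (v, u)})\<^sup>*"
    using R unfolding tree_on_def by auto
  \<comment> \<open>A leftmost face of \<open>U\<close>: the white square beyond its lower left
    corner is outside \<open>U\<close>, so the edge there is on the boundary and belongs to the
    tree.\<close>
  obtain f where f: "f \<in> U" "\<And>g. g \<in> U \<Longrightarrow> fst f \<le> fst g"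
  proof -
    have "Min (fst ` U) \<in> fst ` U" using \<open>U \<noteq> {}\<close> finU by simp
    then obtain f where "f \<in> U" "fst f = Min (fst ` U)" by auto
    then show thesis using that finU by (metis Min_le finite_imageI imageI)
  qed
  let ?o = "(False, False)"
  let ?e = "corner f ?o"
  have f_opp: "opposite f ?o \<notin> U"
    using f(2)[of "opposite f ?o"] by (auto simp: opposite_def split: prod.splits)
  then have "?e \<in> mid ` R" using closed f(1) by blast
  then have "arc ?e \<in> R" using arc_in_tree[OF RA sR] by blast
  then obtain u w where uw: "arc ?e = (u, w)" "(u, w) \<in> R" by (metis prod.exhaust)
  let ?R = "R - {(u, w), (w, u)}"
  define B where "B = {v. (u, v) \<in> ?R\<^sup>*}"
  have B: "u \<in> B" "w \<notin> B" using br[OF uw(2)] by (auto simp: B_def)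
  define cut where "cut e \<longleftrightarrow> (fst (arc e) \<in> B) \<noteq> (snd (arc e) \<in> B)" for e
  have cut_e: "cut ?e" using B uw(1) by (simp add: cut_def)
  have cut_only: "e = ?e" if e: "e \<in> mid ` R" "cut e" for e
  proof (rule ccontr)
    assume "e \<noteq> ?e"
    obtain a b where ab: "arc e = (a, b)" by (rule prod.exhaust)
    have "arc e \<in> R" using arc_in_tree[OF RA sR e(1)] .
    moreover have "arc e \<noteq> (u, w)" "arc e \<noteq> (w, u)"
      using \<open>e \<noteq> ?e\<close> uw(1) mid_arc by (metis, metis swap_simp)
    ultimately have "(a, b) \<in> ?R" using ab by simp
    moreover from this have "(b, a) \<in> ?R" using sR by (auto dest: symD)
    ultimately have "a \<in> B \<longleftrightarrow> b \<in> B"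
      unfolding B_def by (auto intro: rtrancl_into_rtrancl)
    then show False using e(2) ab by (simp add: cut_def)
  qed
  \<comment> \<open>Incidences of cut edges with faces of \<open>U\<close>, even in number at each
    face. All but the one at \<open>f\<close> come in pairs, one from either side: a cut edge other
    than \<open>?e\<close> is not in the tree, so the face beyond it is in \<open>U\<close> as well.
    Thus their number would also be odd.\<close>
  define Y where "Y = (SIGMA g:U. {d. cut (corner g d)})"
  have finY: "finite Y" unfolding Y_def using finU by auto
  have "even (card Y)"
    unfolding Y_def using finU UF even_boundary_crossings
    by (subst card_SigmaI) (auto intro!: dvd_sum simp: cut_def)
  define Z where "Z = Y - {(f, ?o)}"
  define block where "block = (\<lambda>(g, (x, y)). {(g, (x, y)), (opposite g (x, y), (\<not> x, \<not> y))})"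
  have "2 dvd card Z"
  proof (rule dvd_card_blocks)
    show "finite Z" using finY by (simp add: Z_def)
    fix z assume z: "z \<in> Z"
    obtain g x y where gxy: "z = (g, (x, y))" by (metis prod.exhaust)
    have g: "g \<in> U" "cut (corner g (x, y))" "(g, (x, y)) \<noteq> (f, ?o)"
      using z gxy by (auto simp: Z_def Y_def)
    let ?h = "opposite g (x, y)"
    have hU: "?h \<in> U"
    proof (rule ccontr)
      assume "?h \<notin> U"
      then have "corner g (x, y) \<in> mid ` R" using closed g(1) by blast
      then have e: "corner f ?o = corner g (x, y)" using cut_only g(2) by simp
      show False
      proof (cases "f = g")
        case True
        then show False using e g(3) corner_inj by metis
      next
        case False
        then have "g = opposite f ?o" using corner_eqD e f(1) g(1) UF by blast
        then show False using f_opp g(1) by simp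
      qed
    qed
    have "cut (corner ?h (\<not> x, \<not> y))" using g(2) corner_opposite by simp
    moreover have "(?h, (\<not> x, \<not> y)) \<noteq> (f, ?o)"
    proof
      assume "(?h, (\<not> x, \<not> y)) = (f, ?o)"
      then have "case_prod opposite (?h, (\<not> x, \<not> y)) = case_prod opposite (f, ?o)" by (rule arg_cong)
      then have "g = opposite f ?o" by (simp only: case_prod_conv opposite_opposite)
      then show False using f_opp g(1) by simp
    qed
    ultimately have "(?h, (\<not> x, \<not> y)) \<in> Z" using hU by (simp add: Z_def Y_def)
    moreover have "?h \<noteq> g" by (rule opposite_ne)
    ultimately show "block z \<subseteq> Z \<and> z \<in> block z \<and> card (block z) = 2"
      using z gxy by (simp add: block_def)
  next
    fix z z' assume "z' \<in> block z"
    moreover obtain g x y where z: "z = (g, (x, y))" by (metis prod.exhaust)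
    ultimately have "z' = z \<or> z' = (opposite g (x, y), (\<not> x, \<not> y))"
      by (simp only: block_def case_prod_conv insert_iff empty_iff simp_thms)
    then show "block z' = block z"
    proof
      assume "z' = (opposite g (x, y), (\<not> x, \<not> y))"
      then show ?thesis
        by (simp only: z block_def case_prod_conv opposite_opposite not_not insert_commute)
    qed simp
  qed
  moreover have "(f, ?o) \<in> Y" using f(1) cut_e by (simp add: Y_def)
  then have "card Y = Suc (card Z)" using finY unfolding Z_def by (metis card.remove)
  ultimately show False using \<open>even (card Y)\<close> by simp
qed

text \<open>Every face takes the first side of a shortest way out across edges not in the tree;
  distances drop along the choices, so they escape. The crossed edges are then as many as the edges
  missing from the tree, hence the same.\<close>

lemma ex_uncrossed:
  assumes RA: "R \<subseteq> A" and R: "tree_on V R"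
  shows "\<exists>c \<in> F \<rightarrow>\<^sub>E UNIV. escapes F (step c) \<and> uncrossed c = R"
proof -
  have sR: "sym R" using R unfolding tree_on_def by auto
  define X where "X = E - mid ` R"
  define Q where "Q = {(f, g). f \<in> F \<and> (\<exists>d. corner f d \<in> X \<and> g = opposite f d)}"
  \<comment> \<open>The faces from which every way out would have to cross the tree.\<close>
  define U where "U = {f \<in> F. \<forall>g. (f, g) \<in> Q\<^sup>* \<longrightarrow> g \<in> F}"
  have "U = {}"
  proof (rule no_trapped_faces[OF RA R])
    fix g d assume g: "g \<in> U" "corner g d \<notin> mid ` R"
    then have gF: "g \<in> F" by (simp add: U_def)
    then have "corner g d \<in> X" using corner_in_E g(2) by (simp add: X_def)
    with gF have "(g, opposite g d) \<in> Q" unfolding Q_def by blast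
    then show "opposite g d \<in> U"
      using g(1) unfolding U_def by (blast intro: converse_rtrancl_into_rtrancl)
  qed (auto simp: U_def)
  define dist where "dist f = (LEAST k. \<exists>g. g \<notin> F \<and> (f, g) \<in> Q ^^ k)" for f
  have "\<exists>d. corner f d \<in> X \<and> dist (opposite f d) < dist f" if f: "f \<in> F" for f
  proof -
    have "\<exists>g. g \<notin> F \<and> (f, g) \<in> Q\<^sup>*" using \<open>U = {}\<close> f unfolding U_def by blast
    then have "\<exists>k g. g \<notin> F \<and> (f, g) \<in> Q ^^ k" using rtrancl_power by metis
    then have "\<exists>g. g \<notin> F \<and> (f, g) \<in> Q ^^ dist f" unfolding dist_def by (rule LeastI_ex)
    then obtain g where g: "g \<notin> F" "(f, g) \<in> Q ^^ dist f" by blast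
    then have "dist f \<noteq> 0" using f by (cases "dist f = 0") auto
    then obtain k where k: "dist f = Suc k" by (cases "dist f") auto
    then obtain h where h: "(f, h) \<in> Q" "(h, g) \<in> Q ^^ k" using g(2) relpow_Suc_D2 by metis
    have "dist h \<le> k" unfolding dist_def by (rule Least_le) (use g(1) h(2) in blast)
    then have "dist h < dist f" using k by simp
    then show ?thesis using h(1) unfolding Q_def by blast
  qed
  then obtain c where c: "\<And>f. f \<in> F \<Longrightarrow> corner f (c f) \<in> X \<and> dist (opposite f (c f)) < dist f"
    by metis
  define b where "b = restrict c F"
  have b: "corner f (b f) \<in> X" "dist (step b f) < dist f" if "f \<in> F" for f
    using c[OF that] that by (auto simp: b_def)
  have "\<exists>k. (step b ^^ k) f \<notin> F" for f
  proof (induction "dist f" arbitrary: f rule: less_induct)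
    case less
    show ?case
    proof (cases "f \<in> F")
      case True
      then obtain k where "(step b ^^ k) (step b f) \<notin> F" using less b(2) by blast
      then have "(step b ^^ Suc k) f \<notin> F" by (simp only: funpow_Suc_right comp_apply simp_thms)
      then show ?thesis by blast
    next
      case False
      then have "(step b ^^ 0) f \<notin> F" by simp
      then show ?thesis by blast
    qed
  qed
  then have esc: "escapes F (step b)" unfolding escapes_def by blast
  have mR: "mid ` R \<subseteq> E" using RA mid_in_E by blast
  have "card R = 2 * card (mid ` R)"
    using card_arcs[OF mR] tree_eq[OF RA sR] by simp
  moreover have "card R = 2 * (card V - 1)" using tree_on_card[OF R finite_V V_ne] .
  moreover have "card X = card E - card (mid ` R)"
    unfolding X_def using mR finite_E by (simp add: card_Diff_subset finite_subset)
  moreover have "card V \<ge> 1" using V_ne finite_V by (simp add: Suc_leI card_gt_0_iff)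
  ultimately have "card X = card F" using euler by linarith
  moreover have "crossed b \<subseteq> X" using b(1) by (auto simp: crossed_def)
  moreover have "finite X" unfolding X_def using finite_E by simp
  ultimately have "crossed b = X" using card_crossed[OF esc] by (metis card_subset_eq)
  then have "uncrossed b = {x \<in> A. mid x \<in> mid ` R}"
    using mid_in_E by (auto simp: uncrossed_def X_def)
  then have "uncrossed b = R" using tree_eq[OF RA sR] by simp
  then show ?thesis using esc by (intro bexI[of _ b]) (auto simp: b_def)
qed

lemma card_spanning_trees:
  "card {R. R \<subseteq> A \<and> tree_on V R} = card {c \<in> F \<rightarrow>\<^sub>E UNIV. escapes F (step c)}"
proof -
  have "bij_betw uncrossed {c \<in> F \<rightarrow>\<^sub>E UNIV. escapes F (step c)} {R. R \<subseteq> A \<and> tree_on V R}"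
    unfolding bij_betw_def
  proof
    show "inj_on uncrossed {c \<in> F \<rightarrow>\<^sub>E UNIV. escapes F (step c)}"
      by (rule inj_onI) (auto intro: PiE_ext inj_uncrossed)
    show "uncrossed ` {c \<in> F \<rightarrow>\<^sub>E UNIV. escapes F (step c)} = {R. R \<subseteq> A \<and> tree_on V R}"
    proof
      show "uncrossed ` {c \<in> F \<rightarrow>\<^sub>E UNIV. escapes F (step c)} \<subseteq> {R. R \<subseteq> A \<and> tree_on V R}"
        using tree_on_uncrossed by (auto simp: uncrossed_def)
      show "{R. R \<subseteq> A \<and> tree_on V R} \<subseteq> uncrossed ` {c \<in> F \<rightarrow>\<^sub>E UNIV. escapes F (step c)}"
        using ex_uncrossed by blast
    qed
  qed
  then show ?thesis by (rule bij_betw_same_card[symmetric])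
qed

end

section \<open>The spectrum of the face graph\<close>

lemma sin_int_pi: "sin (of_int r * pi) = 0"
  and cos_int_pi: "cos (of_int r * pi) = (if even r then 1 else -1)"
  using sin_npi_int[of r] cos_npi_int[of r] by (simp_all add: mult.commute)

text \<open>Multiplication by \<open>2 sin (x / 2)\<close> makes the sum telescope, as for the
  Dirichlet kernel; the divisibility condition keeps this factor nonzero. The value is -1 for even
  and 0 for odd \<open>r\<close>.\<close>

lemma sum_cos_multiples:
  fixes r :: int
  assumes "N > 0" "\<not> 2 * int N dvd r"
  shows "(\<Sum>j=1..<N. cos (real j * (of_int r * pi / real N))) = - (1 + cos (of_int r * pi)) / 2"
proof -
  define x where "x = of_int r * pi / real N"
  have s: "sin (x / 2) \<noteq> 0"
  proof
    assume "sin (x / 2) = 0"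
    then obtain i :: int where "x / 2 = of_int i * pi" by (auto simp: sin_zero_iff_int2)
    then have "(of_int r :: real) = of_int (2 * int N * i)"
      using assms(1) by (simp add: x_def field_simps)
    then have "r = 2 * int N * i" by linarith
    then show False using assms(2) by simp
  qed
  have "(\<Sum>j=1..<M. 2 * sin (x / 2) * cos (real j * x)) = sin ((real M - 1 / 2) * x) - sin (x / 2)" if "M > 0" for M
    using that
  proof (induction M rule: nat_induct_non_zero)
    case (Suc M)
    have "2 * sin (x / 2) * cos (real M * x) = sin ((real (Suc M) - 1 / 2) * x) - sin ((real M - 1 / 2) * x)"
      using sin_times_cos[of "x / 2" "real M * x"] sin_minus[of "real M * x - x / 2"]
      by (simp add: algebra_simps)
    then show ?case using Suc by simp
  qed simp
  from this[OF assms(1)]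
  have "2 * sin (x / 2) * (\<Sum>j=1..<N. cos (real j * x)) = sin ((real N - 1 / 2) * x) - sin (x / 2)"
    by (simp add: sum_distrib_left)
  also have "(real N - 1 / 2) * x = of_int r * pi - x / 2"
    using assms(1) by (simp add: x_def field_simps)
  also have "sin (of_int r * pi - x / 2) = - cos (of_int r * pi) * sin (x / 2)"
    by (simp add: sin_diff sin_int_pi)
  finally have "sin (x / 2) * (2 * (\<Sum>j=1..<N. cos (real j * x)) + cos (of_int r * pi) + 1) = 0"
    by (simp add: algebra_simps)
  with s have "2 * (\<Sum>j=1..<N. cos (real j * x)) + cos (of_int r * pi) + 1 = 0" by simp
  then show ?thesis unfolding x_def[symmetric] by (simp add: field_simps)
qed

text \<open>Products become differences of cosine sums at \<open>p - q\<close> and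
  \<open>p + q\<close>. These have equal parity, so for \<open>p \<noteq> q\<close> the two sums
  cancel.\<close>

lemma sum_sin_sin:
  fixes p q :: int
  assumes "0 < p" "p < int N" "0 < q" "q < int N"
  shows "(\<Sum>j=1..<N. sin (real j * (of_int p * pi / real N)) * sin (real j * (of_int q * pi / real N))) =
    (if p = q then real N / 2 else 0)"
proof -
  have N: "N > 0" using assms by simp
  let ?C = "\<lambda>r :: int. \<Sum>j=1..<N. cos (real j * (of_int r * pi / real N))"
  have "(\<Sum>j=1..<N. sin (real j * (of_int p * pi / real N)) * sin (real j * (of_int q * pi / real N))) =
      (?C (p - q) - ?C (p + q)) / 2"
    unfolding sum_subtractf[symmetric] sum_divide_distrib
    by (rule sum.cong) (simp_all add: sin_times_sin algebra_simps add_divide_distrib diff_divide_distrib)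
  moreover have "?C (p + q) = - (1 + cos (of_int (p + q) * pi)) / 2"
    by (rule sum_cos_multiples[OF N]) (use assms in \<open>auto dest: zdvd_imp_le\<close>)
  moreover have "?C (p - q) = (if p = q then real N - 1 else - (1 + cos (of_int (p - q) * pi)) / 2)"
  proof (cases "p = q")
    case False
    have "\<not> 2 * int N dvd p - q"
    proof
      assume "2 * int N dvd p - q"
      then have "2 * int N \<le> \<bar>p - q\<bar>" using False by (metis dvd_imp_le_int right_minus_eq abs_of_nonneg of_nat_0_le_iff mult_nonneg_nonneg zero_le_numeral)
      then show False using assms by auto
    qed
    then show ?thesis using False sum_cos_multiples[OF N, of "p - q"] by simp
  qed (use N in simp)
  moreover have "cos (of_int (p + q) * pi) = cos (of_int (p - q) * pi)"
    by (simp only: cos_int_pi even_add even_diff)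
  ultimately show ?thesis by (cases "p = q") (simp_all only: if_True if_False simp_thms, simp_all add: cos_int_pi)
qed

text \<open>Reflects the position, with a sign depending on the frequency; the next lemma reflects
  the frequency, with a sign depending on the position.\<close>

lemma sin_reflect:
  assumes "N > 0"
  shows "sin (real j * (of_int (int N - p) * pi / real N)) = - ((-1) ^ j) * sin (real j * (of_int p * pi / real N))"
proof -
  have "real j * (of_int (int N - p) * pi / real N) = real j * pi - real j * (of_int p * pi / real N)"
    using assms by (simp add: field_simps)
  then show ?thesis by (simp add: sin_diff)
qed

lemma sin_reflect':
  assumes "N > 0" "j \<le> N"
  shows "sin (real (N - j) * (of_int p * pi / real N)) =
    - (if even p then 1 else -1) * sin (real j * (of_int p * pi / real N))"
proof -
  have "real (N - j) * (of_int p * pi / real N) = of_int p * pi - real j * (of_int p * pi / real N)"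
    using assms by (simp add: field_simps of_nat_diff)
  then show ?thesis by (simp add: sin_diff sin_int_pi cos_int_pi)
qed

text \<open>One of the four triangles into which the diagonals cut the square of all frequencies
  from 1 to \<open>2 m - 1\<close>. On the diagonals the modes vanish on the faces, and the other
  triangles repeat these modes up to sign.\<close>

definition mode_index :: "nat \<Rightarrow> (nat \<times> nat) set" where
  "mode_index m = {(j, k). 1 \<le> j \<and> j < k \<and> k \<le> 2 * m - 1 \<and> j + k \<le> 2 * m - 1}"

text \<open>
  In the coordinates \<open>p\<close> and \<open>b = 2 m - 1 - q\<close> the faces fill the triangle \<open>p, b \<ge> 1\<close>,
  \<open>p + b \<le> 2 m - 2\<close>.  Antisymmetry under \<open>(p, b) \<mapsto> (2 m - b, 2 m - p)\<close> makes the product of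
  sines vanish on the third side \<open>p + b = 2 m\<close> too.
\<close>

definition mode :: "nat \<Rightarrow> nat \<times> nat \<Rightarrow> int \<times> int \<Rightarrow> real" where
  "mode m = (\<lambda>(j, k) (p, q). let s = (\<lambda>l (a :: int). sin (real l * (of_int a * pi / real (2 * m)))); b = int (2 * m) - 1 - q in
     s j p * s k b - (-1) ^ (j + k) * s k p * s j b)"

locale half_board_nat =
  fixes m :: nat
  assumes m_pos: "m \<ge> 1"

sublocale half_board_nat \<subseteq> half_board "int m"
  using m_pos by unfold_locales simp

context half_board_nat
begin

definition sine :: "nat \<Rightarrow> int \<Rightarrow> real" where
  "sine l a = sin (real l * (of_int a * pi / real (2 * m)))"

lemma mode_eq: "mode m (j, k) (p, q) =
    sine j p * sine k (int (2 * m) - 1 - q) - (-1) ^ (j + k) * sine k p * sine j (int (2 * m) - 1 - q)"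
  by (simp add: mode_def sine_def)

lemma finite_mode_index: "finite (mode_index m)"
  by (rule finite_subset[of _ "{..2 * m} \<times> {..2 * m}"]) (auto simp: mode_index_def)

text \<open>Row \<open>q\<close> of the faces matches the line \<open>j + k = q + 1\<close>, and
  \<open>j\<close> numbers the faces of that row from the left: \<open>p\<close> is
  \<open>2 j - 1\<close> or \<open>2 j\<close>, whichever has the parity opposite to
  \<open>q\<close>.\<close>

lemma card_F: "card F = card (mode_index m)"
proof -
  let ?f = "\<lambda>(j, k). (if even (j + k - 1) then 2 * int j - 1 else 2 * int j, int (j + k) - 1)"
  let ?g = "\<lambda>(p, q). (nat ((p + 1) div 2), nat (q + 1 - (p + 1) div 2))"
  have f: "?f x \<in> F \<and> ?g (?f x) = x" if x: "x \<in> mode_index m" for x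
  proof -
    obtain j k where jk: "1 \<le> j" "j < k" "j + k \<le> 2 * m - 1" "x = (j, k)"
      using x by (auto simp: mode_index_def)
    show ?thesis
    proof (cases "even (j + k - 1)")
      case True
      then show ?thesis using jk by (auto simp: F_def)
    next
      case False
      \<comment> \<open>Here \<open>j + k\<close> is even, so \<open>k\<close> is at least
        \<open>j + 2\<close>, just enough for \<open>2 j < j + k - 1\<close>.\<close>
      then have "k \<noteq> Suc j" by auto
      then show ?thesis using jk False by (auto simp: F_def)
    qed
  qed
  have g: "?g y \<in> mode_index m \<and> ?f (?g y) = y" if y: "y \<in> F" for y
  proof -
    obtain p q where pq: "1 \<le> p" "p < q" "q \<le> 2 * int m - 2" "odd (p + q)" "y = (p, q)"
      using y by (auto simp: F_def)
    define j k where "j = nat ((p + 1) div 2)" and "k = nat (q + 1 - (p + 1) div 2)"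
    have jk: "int j = (p + 1) div 2" "int k = q + 1 - (p + 1) div 2"
      using pq by (auto simp: j_def k_def)
    have "1 \<le> j" "j < k" "j + k \<le> 2 * m - 1" "int (j + k) = q + 1" using pq jk by linarith+
    moreover have "even (j + k - 1) \<longleftrightarrow> even q"
    proof -
      have "int (j + k - 1) = q" using \<open>int (j + k) = q + 1\<close> \<open>1 \<le> j\<close> by linarith
      then show ?thesis by (metis even_of_nat)
    qed
    moreover have "2 * int j = (if even q then p + 1 else p)" using pq(4) jk(1) by presburger
    ultimately show ?thesis
      unfolding pq(5) case_prod_conv j_def[symmetric] k_def[symmetric] by (auto simp: mode_index_def)
  qed
  have "bij_betw ?f (mode_index m) F"
    by (rule bij_betw_byWitness[of _ ?g]) (use f g in blast)+
  then show ?thesis by (rule bij_betw_same_card[symmetric])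
qed

lemma sine_0: "sine l 0 = 0"
  by (simp add: sine_def)

lemma sine_reflect: "sine l (int (2 * m) - a) = - ((-1) ^ l) * sine l a"
  using sin_reflect[of "2 * m" l a] m_pos by (simp add: sine_def)

lemma sine_shift: "sine l (a + 1) + sine l (a - 1) = 2 * cos (real l * pi / (2 * real m)) * sine l a"
proof -
  have "real l * (of_int (a + 1) * pi / real (2 * m)) = real l * (of_int a * pi / real (2 * m)) + real l * pi / (2 * real m)"
    "real l * (of_int (a - 1) * pi / real (2 * m)) = real l * (of_int a * pi / real (2 * m)) - real l * pi / (2 * real m)"
    using m_pos by (simp_all add: field_simps)
  then show ?thesis by (simp only: sine_def sin_add sin_diff) simp
qed

text \<open>A step out of \<open>F\<close> lands exactly on one of the three zero lines, never
  beyond. Hence a sum over neighbouring faces may run over all four neighbours.\<close>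

lemma mode_boundary:
  assumes "f \<in> F" "opposite f d \<notin> F"
  shows "mode m x (opposite f d) = 0"
proof -
  obtain p q u v where fd: "f = (p, q)" "d = (u, v)" by (metis prod.exhaust)
  obtain p' q' where h: "opposite f d = (p', q')" by fastforce
  have "1 \<le> p" "p < q" "q \<le> 2 * int m - 2" "odd (p + q)"
    using assms(1) by (auto simp: fd F_def)
  moreover have "p' = (if u then p + 1 else p - 1)" "q' = (if v then q + 1 else q - 1)"
    using h by (auto simp: fd opposite_def)
  moreover have "\<not> (1 \<le> p' \<and> p' < q' \<and> q' \<le> 2 * int m - 2 \<and> odd (p' + q'))"
    using assms(2) h by (simp add: F_def)
  ultimately have "p' = 0 \<or> q' = 2 * int m - 1 \<or> q' = p' - 1"
    by (cases u; cases v; simp; presburger)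
  then consider "p' = 0" | "q' = 2 * int m - 1" | "q' = p' - 1" by blast
  then show ?thesis
  proof cases
    case 3
    have "int (2 * m) - 1 - q' = int (2 * m) - p'" using 3 by simp
    then show ?thesis
      unfolding h by (cases x) (simp only: mode_eq sine_reflect, simp add: power_add algebra_simps)
  qed (cases x; simp add: h mode_eq sine_0)+
qed

lemma sum_opposite:
  "(\<Sum>d\<in>UNIV. w (opposite (p, q) d)) = w (p - 1, q - 1) + w (p + 1, q - 1) + w (p - 1, q + 1) + (w (p + 1, q + 1) :: real)"
proof -
  have U: "(UNIV :: (bool \<times> bool) set) = {(False, False), (True, False), (False, True), (True, True)}"
    by (auto simp: UNIV_bool)
  show ?thesis unfolding U by (simp add: opposite_def)
qed

text \<open>The neighbours are diagonal, so their sum factors into one-dimensional ones, each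
  multiplying a sine by twice a cosine. Both terms of the mode pick up the same factor.\<close>

lemma mode_eigen:
  assumes f: "f \<in> F"
  shows "(\<Sum>g\<in>F. (\<Sum>d\<in>UNIV. of_bool (f = g) - of_bool (opposite f d = g)) * mode m (j, k) g) =
    (4 - 4 * cos (real j * pi / (2 * real m)) * cos (real k * pi / (2 * real m))) * mode m (j, k) f"
proof -
  let ?v = "mode m (j, k)"
  let ?cj = "cos (real j * pi / (2 * real m))" and ?ck = "cos (real k * pi / (2 * real m))"
  obtain p q where pq: "f = (p, q)" by fastforce
  have "(\<Sum>g\<in>F. (\<Sum>d\<in>UNIV. of_bool (f = g) - of_bool (opposite f d = g)) * ?v g) =
      (\<Sum>d\<in>UNIV. \<Sum>g\<in>F. (of_bool (f = g) - of_bool (opposite f d = g)) * ?v g)"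
    unfolding sum_distrib_right by (rule sum.swap)
  also have "\<dots> = (\<Sum>d\<in>UNIV. ?v f - ?v (opposite f d))"
  proof (rule sum.cong)
    fix d :: "bool \<times> bool"
    have "(\<Sum>g\<in>F. (of_bool (f = g) - of_bool (opposite f d = g)) * ?v g) =
        (\<Sum>g\<in>F. if g = f then ?v g else 0) - (\<Sum>g\<in>F. if g = opposite f d then ?v g else 0)"
      unfolding sum_subtractf[symmetric] by (rule sum.cong) auto
    also have "\<dots> = ?v f - ?v (opposite f d)"
      using f finite_F mode_boundary[OF f] by (simp add: sum.delta)
    finally show "(\<Sum>g\<in>F. (of_bool (f = g) - of_bool (opposite f d = g)) * ?v g) = ?v f - ?v (opposite f d)" .
  qed simp
  also have "\<dots> = 4 * ?v f - (\<Sum>d\<in>UNIV. ?v (opposite f d))"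
  proof -
    have "card (UNIV :: (bool \<times> bool) set) = 4"
      unfolding UNIV_Times_UNIV[symmetric] card_cartesian_product by simp
    then show ?thesis by (simp add: sum_subtractf)
  qed
  also have "(\<Sum>d\<in>UNIV. ?v (opposite f d)) = 4 * ?cj * ?ck * ?v f"
  proof -
    let ?b = "int (2 * m) - 1 - q"
    have b: "int (2 * m) - 1 - (q - 1) = ?b + 1" "int (2 * m) - 1 - (q + 1) = ?b - 1" by auto
    have "(\<Sum>d\<in>UNIV. ?v (opposite f d)) =
        (sine j (p + 1) + sine j (p - 1)) * (sine k (?b + 1) + sine k (?b - 1)) -
        (-1) ^ (j + k) * (sine k (p + 1) + sine k (p - 1)) * (sine j (?b + 1) + sine j (?b - 1))"
      unfolding pq sum_opposite mode_eq b by (simp add: algebra_simps)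
    also have "\<dots> = 4 * ?cj * ?ck * ?v f"
      unfolding sine_shift pq mode_eq by (simp add: algebra_simps)
    finally show ?thesis .
  qed
  finally show ?thesis by (simp add: algebra_simps)
qed

lemma sum_sine_sine:
  assumes "0 < a" "a < int (2 * m)" "0 < b" "b < int (2 * m)"
  shows "(\<Sum>j=1..<2 * m. sine j a * sine j b) = (if a = b then real m else 0)"
  using sum_sin_sin[OF assms] by (simp add: sine_def)

text \<open>The alternating sign is absorbed by moving one point to \<open>2 m - a\<close>.\<close>

lemma sum_alternating_sine_sine:
  assumes "0 < a" "a < int (2 * m)" "0 < b" "b < int (2 * m)"
  shows "(\<Sum>j=1..<2 * m. (-1) ^ j * sine j a * sine j b) = (if a + b = int (2 * m) then - real m else 0)"
proof -
  have "(\<Sum>j=1..<2 * m. (-1) ^ j * sine j a * sine j b) = - (\<Sum>j=1..<2 * m. sine j (int (2 * m) - a) * sine j b)"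
    unfolding sine_reflect sum_negf[symmetric] by (rule sum.cong) simp_all
  also have "\<dots> = (if a + b = int (2 * m) then - real m else 0)"
    by (subst sum_sine_sine) (use assms in auto)
  finally show ?thesis .
qed

text \<open>Over the full square of frequencies the sum splits into products of one-dimensional
  sums, and for equal faces two of these products contribute \<open>m\<^sup>2\<close> each. A
  quarter of that is the constant.\<close>

lemma mode_orthogonal:
  assumes f: "f \<in> F" and g: "g \<in> F"
  shows "(\<Sum>x\<in>mode_index m. mode m x f * mode m x g) = (if f = g then (real m)\<^sup>2 / 2 else 0)"
proof -
  obtain p q p' q' where pq: "f = (p, q)" "g = (p', q')" by (metis prod.exhaust)
  define b b' where "b = int (2 * m) - 1 - q" and "b' = int (2 * m) - 1 - q'"
  have bounds: "0 < p" "0 < b" "p + b \<le> int (2 * m) - 2" "0 < p'" "0 < b'" "p' + b' \<le> int (2 * m) - 2"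
    using f g by (auto simp: pq F_def b_def b'_def)
  have par: "even (p + b)" "even (p' + b')"
    using f g by (auto simp: pq F_def b_def b'_def)
  let ?w = "\<lambda>x. mode m x f * mode m x g"
  let ?I = "{1..<2 * m}"
  let ?Q = "?I \<times> ?I"
  let ?N = "2 * m"
  have w: "?w (j, k) = (sine j p * sine k b - (-1) ^ (j + k) * sine k p * sine j b) *
      (sine j p' * sine k b' - (-1) ^ (j + k) * sine k p' * sine j b')" for j k
    by (simp add: pq mode_eq b_def b'_def)
  have sq: "((-1) ^ l :: real) * (-1) ^ l = 1" for l :: nat by (simp flip: power_add)
  have swap: "?w (k, j) = ?w (j, k)" for j k
  proof -
    let ?e = "(-1) ^ (j + k) :: real"
    have flip: "y - ?e * x = - ?e * (x - ?e * y)" for x y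
      using sq[of "j + k"] by (simp add: right_diff_distrib flip: mult.assoc)
    have "sine k p * sine j b - ?e * sine j p * sine k b = - ?e * (sine j p * sine k b - ?e * sine k p * sine j b)"
      using flip[of "sine k p * sine j b" "sine j p * sine k b"] by (simp only: mult.assoc)
    moreover have "sine k p' * sine j b' - ?e * sine j p' * sine k b' = - ?e * (sine j p' * sine k b' - ?e * sine k p' * sine j b')"
      using flip[of "sine k p' * sine j b'" "sine j p' * sine k b'"] by (simp only: mult.assoc)
    moreover have "(- ?e * x) * (- ?e * y) = x * y" for x y
    proof -
      have "(- ?e * x) * (- ?e * y) = (?e * ?e) * (x * y)" by (simp only: minus_mult_minus mult_minus_left mult_minus_right minus_minus ac_simps)
      then show ?thesis by (simp only: sq mult_1)
    qed
    ultimately show ?thesis unfolding w add.commute[of k j] by (simp only:)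
  qed
  have s': "sine (?N - l) a = - (if even a then 1 else -1) * sine l a" if "l \<le> ?N" for l a
    using sin_reflect'[of ?N l a] that m_pos by (simp add: sine_def)
  \<comment> \<open>\<open>p\<close> and \<open>b\<close> have equal parity, as have
    \<open>p'\<close> and \<open>b'\<close>, so the signs cancel.\<close>
  have refl: "?w (?N - j, ?N - k) = ?w (j, k)" if "j \<le> ?N" "k \<le> ?N" for j k
  proof -
    have "(-1) ^ (?N - j + (?N - k)) = ((-1) ^ (j + k) :: real)"
      using that by (simp add: minus_one_power_iff)
    then show ?thesis unfolding w s'[OF that(1)] s'[OF that(2)] using par by auto
  qed
  have zero: "?w (j, k) = 0" if "j = k \<or> j + k = ?N" for j k
    using that
  proof
    assume "j = k"
    then show ?thesis unfolding w by (simp add: power_add[symmetric])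
  next
    assume jk: "j + k = ?N"
    then have k: "k = ?N - j" "j \<le> ?N" by auto
    have "(-1) ^ (j + k) = (1 :: real)" unfolding jk by simp
    moreover have "sine j p * sine k b = sine k p * sine j b"
      unfolding k(1) s'[OF k(2)] using par by simp
    ultimately show ?thesis unfolding w by simp
  qed
  \<comment> \<open>The index square is cut by its diagonals into four copies of the index set.\<close>
  let ?J = "mode_index m"
  let ?J2 = "{(j, k). (j, k) \<in> ?Q \<and> k < j \<and> j + k < ?N}"
  let ?J3 = "{(j, k). (j, k) \<in> ?Q \<and> j < k \<and> j + k > ?N}"
  let ?J4 = "{(j, k). (j, k) \<in> ?Q \<and> k < j \<and> j + k > ?N}"
  have J: "?J = {(j, k). (j, k) \<in> ?Q \<and> j < k \<and> j + k < ?N}"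
    using m_pos by (auto simp: mode_index_def)
  have sub: "?J \<subseteq> ?Q" "?J2 \<subseteq> ?Q" "?J3 \<subseteq> ?Q" "?J4 \<subseteq> ?Q" unfolding J by auto
  then have fin: "finite ?J" "finite ?J2" "finite ?J3" "finite ?J4"
    using finite_subset[of _ ?Q] by auto
  have "sum ?w ?Q = sum ?w (?J \<union> ?J2 \<union> (?J3 \<union> ?J4))"
  proof (rule sum.mono_neutral_right)
    show "\<forall>x\<in>?Q - (?J \<union> ?J2 \<union> (?J3 \<union> ?J4)). ?w x = 0"
    proof
      fix x assume x: "x \<in> ?Q - (?J \<union> ?J2 \<union> (?J3 \<union> ?J4))"
      obtain j k where jk: "x = (j, k)" by fastforce
      then have "j = k \<or> j + k = ?N" using x unfolding J by auto
      then show "?w x = 0" using zero jk by blast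
    qed
  qed (use sub in auto)
  also have "\<dots> = sum ?w ?J + sum ?w ?J2 + (sum ?w ?J3 + sum ?w ?J4)"
  proof -
    have "(?J \<union> ?J2) \<inter> (?J3 \<union> ?J4) = {}" "?J \<inter> ?J2 = {}" "?J3 \<inter> ?J4 = {}" unfolding J by auto
    then show ?thesis using fin by (simp add: sum.union_disjoint)
  qed
  also have "sum ?w ?J2 = sum ?w ?J"
    by (rule sum.reindex_bij_witness[of _ prod.swap prod.swap])
      (use swap in \<open>auto simp: J\<close>)
  also have "sum ?w ?J3 = sum ?w ?J"
    by (rule sum.reindex_bij_witness[of _ "\<lambda>(j, k). (?N - k, ?N - j)" "\<lambda>(j, k). (?N - k, ?N - j)"])
      (use swap refl in \<open>auto simp: J\<close>)
  also have "sum ?w ?J4 = sum ?w ?J"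
    by (rule sum.reindex_bij_witness[of _ "\<lambda>(j, k). (?N - j, ?N - k)" "\<lambda>(j, k). (?N - j, ?N - k)"])
      (use refl in \<open>auto simp: J\<close>)
  finally have four: "sum ?w ?Q = 4 * sum ?w ?J" by simp
  have "sum ?w ?Q = (\<Sum>j\<in>?I. \<Sum>k\<in>?I. ?w (j, k))"
    by (simp add: sum.cartesian_product)
  also have "\<dots> = (\<Sum>j\<in>?I. \<Sum>k\<in>?I. (sine j p * sine j p') * (sine k b * sine k b') + (sine j b * sine j b') * (sine k p * sine k p')
      - ((-1) ^ j * sine j p * sine j b') * ((-1) ^ k * sine k b * sine k p')
      - ((-1) ^ j * sine j p' * sine j b) * ((-1) ^ k * sine k b' * sine k p))"
  proof (intro sum.cong refl)
    fix j k
    let ?e = "(-1) ^ j * (-1) ^ k :: real"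
    have "?w (j, k) = (sine j p * sine j p') * (sine k b * sine k b') + (?e * ?e) * ((sine j b * sine j b') * (sine k p * sine k p'))
        - ((-1) ^ j * sine j p * sine j b') * ((-1) ^ k * sine k b * sine k p')
        - ((-1) ^ j * sine j p' * sine j b) * ((-1) ^ k * sine k b' * sine k p)"
    proof -
      have ring: "(a - x * y * c) * (a' - x * y * c') = a * a' + (x * y * (x * y)) * (c * c') - x * y * (a * c') - x * y * (a' * c)"
        for a a' c c' x y :: real by (simp add: algebra_simps)
      show ?thesis
        unfolding w power_add
        using ring[of "sine j p * sine k b" "(-1) ^ j" "(-1) ^ k" "sine k p * sine j b" "sine j p' * sine k b'" "sine k p' * sine j b'"]
        by (simp only: ac_simps)
    qed
    also have "?e * ?e = 1" using sq[of "j + k"] by (simp only: power_add)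
    finally show "?w (j, k) = (sine j p * sine j p') * (sine k b * sine k b') + (sine j b * sine j b') * (sine k p * sine k p')
        - ((-1) ^ j * sine j p * sine j b') * ((-1) ^ k * sine k b * sine k p')
        - ((-1) ^ j * sine j p' * sine j b) * ((-1) ^ k * sine k b' * sine k p)" by (simp only: mult_1)
  qed simp_all
  also have "\<dots> = (\<Sum>j\<in>?I. sine j p * sine j p') * (\<Sum>k\<in>?I. sine k b * sine k b') + (\<Sum>j\<in>?I. sine j b * sine j b') * (\<Sum>k\<in>?I. sine k p * sine k p')
      - (\<Sum>j\<in>?I. (-1) ^ j * sine j p * sine j b') * (\<Sum>k\<in>?I. (-1) ^ k * sine k b * sine k p')
      - (\<Sum>j\<in>?I. (-1) ^ j * sine j p' * sine j b) * (\<Sum>k\<in>?I. (-1) ^ k * sine k b' * sine k p)"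
    by (simp only: sum_product sum.distrib sum_subtractf)
  also have "\<dots> = (if p = p' \<and> b = b' then 2 * (real m)\<^sup>2 else 0)"
  proof -
    have lt: "p < int ?N" "b < int ?N" "p' < int ?N" "b' < int ?N" using bounds by auto
    \<comment> \<open>The mixed terms survive only if both sums are \<open>2 m\<close>, but the four
      coordinates add up to at most \<open>4 m - 4\<close>.\<close>
    have "\<not> (p + b' = int ?N \<and> b + p' = int ?N)" using bounds by auto
    then show ?thesis
      unfolding sum_sine_sine[OF bounds(1) lt(1) bounds(4) lt(3)] sum_sine_sine[OF bounds(2) lt(2) bounds(5) lt(4)]
        sum_alternating_sine_sine[OF bounds(1) lt(1) bounds(5) lt(4)] sum_alternating_sine_sine[OF bounds(2) lt(2) bounds(4) lt(3)]
        sum_alternating_sine_sine[OF bounds(4) lt(3) bounds(2) lt(2)] sum_alternating_sine_sine[OF bounds(5) lt(4) bounds(1) lt(1)]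
      by (auto simp: power2_eq_square)
  qed
  also have "p = p' \<and> b = b' \<longleftrightarrow> f = g" by (auto simp: pq b_def b'_def)
  finally show ?thesis using four by (auto split: if_splits)
qed

lemma det_faces:
  "det_on F (\<lambda>f g. \<Sum>d\<in>UNIV. of_bool (f = g) - of_bool (opposite f d = g)) =
    (\<Prod>(j, k)\<in>mode_index m. 4 - 4 * cos (real j * pi / (2 * real m)) * cos (real k * pi / (2 * real m)))"
proof (rule det_on_eigen[of _ _ _ "mode m" _ "(real m)\<^sup>2 / 2"])
  fix x f assume "x \<in> mode_index m" "f \<in> F"
  then show "(\<Sum>g\<in>F. (\<Sum>d\<in>UNIV. of_bool (f = g) - of_bool (opposite f d = g)) * mode m x g) =
      (case x of (j, k) \<Rightarrow> 4 - 4 * cos (real j * pi / (2 * real m)) * cos (real k * pi / (2 * real m))) * mode m x f"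
    using mode_eigen by (cases x) simp
qed (use finite_F finite_mode_index card_F mode_orthogonal m_pos in auto)

lemma card_spanning_trees_formula:
  "real (card {R. R \<subseteq> A \<and> tree_on V R}) =
    (\<Prod>(j, k)\<in>mode_index m. 4 - 4 * cos (real j * pi / (2 * real m)) * cos (real k * pi / (2 * real m)))"
  unfolding card_spanning_trees det_faces[symmetric]
  by (rule det_on_count_escaping[symmetric]) (auto simp: finite_F opposite_ne)

end

section \<open>The Aztec diamond\<close>

definition aztec_verts :: "nat \<Rightarrow> (real \<times> real) set" where
  "aztec_verts n = {(of_int a + 1 / 2, of_int b + 1 / 2) | a b :: int.
     \<bar>of_int a + 1 / 2 :: real\<bar> + \<bar>of_int b + 1 / 2\<bar> \<le> real n}"

definition aztec_arcs :: "nat \<Rightarrow> ((real \<times> real) \<times> (real \<times> real)) set" where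
  "aztec_arcs n = {((x, y), (x', y')). (x, y) \<in> aztec_verts n \<and> (x', y') \<in> aztec_verts n \<and>
     \<bar>x - x'\<bar> + \<bar>y - y'\<bar> = 1}"

lemma aztec_diamond_eq:
  "aztec_diamond n = with_proj \<lparr> pverts = aztec_verts n, parcs = aztec_arcs n \<rparr>"
proof -
  let ?S = "{(of_int i + 1/2, of_int j + 1/2) | i j :: int. True} :: (real \<times> real) set"
  have v: "{(x, y) \<in> ?S. \<bar>x\<bar> + \<bar>y\<bar> \<le> real n} = aztec_verts n"
    by (auto simp: aztec_verts_def)
  then have "aztec_verts n \<subseteq> ?S" by blast
  then have a: "{((x, y), (x', y')). (x, y) \<in> ?S \<and> (x', y') \<in> ?S \<and> \<bar>x - x'\<bar> + \<bar>y - y'\<bar> = 1}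
      \<inter> aztec_verts n \<times> aztec_verts n = aztec_arcs n"
    unfolding aztec_arcs_def by blast
  show ?thesis
    unfolding aztec_diamond_def half_grid_def Let_def with_proj_restrict with_proj_simps
      pair_pre_digraph.simps v a ..
qed

lemma aztec_arcs_subset: "aztec_arcs n \<subseteq> aztec_verts n \<times> aztec_verts n"
  by (auto simp: aztec_arcs_def)

lemma irrefl_aztec_arcs: "irrefl (aztec_arcs n)"
  by (auto simp: aztec_arcs_def irrefl_def)

lemma neg_half_integer: "\<exists>b :: int. - (of_int a + 1 / 2 :: real) = of_int b + 1 / 2"
  by (rule exI[of _ "- a - 1"]) simp

lemma aztec_verts_neg:
  assumes "(x, y) \<in> aztec_verts n"
  shows "(x, - y) \<in> aztec_verts n" "(- x, y) \<in> aztec_verts n"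
proof -
  obtain a b :: int where ab: "x = of_int a + 1 / 2" "y = of_int b + 1 / 2" "\<bar>x\<bar> + \<bar>y\<bar> \<le> real n"
    using assms by (auto simp: aztec_verts_def)
  obtain a' :: int where "- x = of_int a' + 1 / 2" using neg_half_integer ab(1) by metis
  moreover obtain b' :: int where "- y = of_int b' + 1 / 2" using neg_half_integer ab(2) by metis
  moreover have "\<bar>x\<bar> + \<bar>- y\<bar> \<le> real n" "\<bar>- x\<bar> + \<bar>y\<bar> \<le> real n" using ab(3) by simp_all
  ultimately show "(x, - y) \<in> aztec_verts n" "(- x, y) \<in> aztec_verts n"
    using ab(1,2) unfolding aztec_verts_def mem_Collect_eq by (metis, metis)
qed

lemma half_integer_abs: "\<bar>of_int a + 1 / 2 :: real\<bar> \<ge> 1 / 2"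
proof (cases "a \<ge> 0")
  case False
  then have "(of_int a :: real) \<le> -1" by linarith
  then show ?thesis by linarith
qed simp

lemma aztec_verts_abs:
  assumes "(x, y) \<in> aztec_verts n"
  shows "\<bar>x\<bar> \<ge> 1 / 2" "\<bar>y\<bar> \<ge> 1 / 2"
  using assms half_integer_abs by (auto simp: aztec_verts_def)

lemma map_prod_image_eq:
  assumes "g ` W = V" "C \<subseteq> W \<times> W" "A \<subseteq> V \<times> V"
    and "\<And>s t. s \<in> W \<Longrightarrow> t \<in> W \<Longrightarrow> (s, t) \<in> C \<longleftrightarrow> (g s, g t) \<in> A"
  shows "map_prod g g ` C = A"
proof
  show "map_prod g g ` C \<subseteq> A" using assms(2,4) by auto
  show "A \<subseteq> map_prod g g ` C"
  proof
    fix x assume x: "x \<in> A"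
    then have "fst x \<in> g ` W" "snd x \<in> g ` W" using assms(1,3) by auto
    then obtain s t where st: "s \<in> W" "t \<in> W" "x = (g s, g t)" by (metis imageE prod.collapse)
    then have "(s, t) \<in> C" using assms(4) x by blast
    then show "x \<in> map_prod g g ` C" using st(3) by force
  qed
qed

section \<open>The upper half of the diamond as a copy of the half board\<close>

context half_board_nat
begin

text \<open>A turn by 45 degrees with scaling, in which \<open>x - y = i - m\<close> and
  \<open>x + y = j + 1 - m\<close>. The squares of the diagonal land on \<open>y = 1/2\<close>, just
  above the axis.\<close>

definition plane :: "int \<times> int \<Rightarrow> real \<times> real" where
  "plane = (\<lambda>(i, j). ((of_int i + of_int j) / 2 - real m + 1 / 2, (of_int j - of_int i) / 2 + 1 / 2))"

definition upper :: "(real \<times> real) set" where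
  "upper = plane ` V"

lemma inj_plane: "inj plane"
proof (rule injI)
  fix u v assume "plane u = plane v"
  then have "fst (plane u) + snd (plane u) = fst (plane v) + snd (plane v)"
    "fst (plane u) - snd (plane u) = fst (plane v) - snd (plane v)" by simp_all
  then show "u = v" by (cases u; cases v) (simp add: plane_def field_simps)
qed

text \<open>In terms of \<open>x - y\<close> and \<open>x + y\<close>, the bound on
  \<open>\<bar>x\<bar> + y\<close> becomes \<open>0 \<le> i\<close> and \<open>j < 2 m\<close>, and
  \<open>y > 0\<close> becomes \<open>i \<le> j\<close>.\<close>

lemma upper_eq: "upper = {(x, y) \<in> aztec_verts m. y > 0}"
proof
  show "upper \<subseteq> {(x, y) \<in> aztec_verts m. y > 0}"
  proof
    fix z assume "z \<in> upper"
    then obtain i j where ij: "0 \<le> i" "i \<le> j" "j < 2 * int m" "even (i + j)" "z = plane (i, j)"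
      by (auto simp: upper_def V_def)
    define a b where "a = (i + j) div 2 - int m" and "b = (j - i) div 2"
    have "even (j - i)" using ij(4) by presburger
    then have eq: "2 * (a + int m) = i + j" "2 * b = j - i" using ij(4) by (auto simp: a_def b_def)
    have "real_of_int (2 * (a + int m)) = of_int (i + j)" "real_of_int (2 * b) = of_int (j - i)"
      by (simp_all only: eq)
    then have *: "(real_of_int i + of_int j) / 2 = of_int a + real m" "(real_of_int j - of_int i) / 2 = of_int b"
      by simp_all
    have z: "z = (of_int a + 1 / 2, of_int b + 1 / 2)"
      unfolding ij(5) plane_def case_prod_conv * by simp
    have "0 \<le> b" "a + b + 1 \<le> int m" "b - a \<le> int m" using eq ij(1-3) by auto
    then have "0 \<le> real_of_int b" "real_of_int a + of_int b + 1 \<le> real m" "real_of_int b - of_int a \<le> real m" by linarith+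
    then show "z \<in> {(x, y) \<in> aztec_verts m. y > 0}"
      unfolding z aztec_verts_def by (auto simp: abs_if)
  qed
  show "{(x, y) \<in> aztec_verts m. y > 0} \<subseteq> upper"
  proof clarify
    fix x y assume "(x, y) \<in> aztec_verts m" "y > 0"
    then obtain a b where ab: "x = of_int a + 1 / 2" "y = of_int b + 1 / 2" "\<bar>x\<bar> + \<bar>y\<bar> \<le> real m"
      by (auto simp: aztec_verts_def)
    define i j where "i = a + int m - b" and "j = a + int m + b"
    have "0 \<le> b" using \<open>y > 0\<close> ab(2) by linarith
    moreover have "0 \<le> i" "j < 2 * int m" using ab \<open>y > 0\<close> unfolding i_def j_def by linarith+
    ultimately have "(i, j) \<in> V" by (auto simp: V_def i_def j_def)
    moreover have "(x, y) = plane (i, j)" by (simp add: plane_def i_def j_def ab(1,2) field_simps)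
    ultimately show "(x, y) \<in> upper" by (simp add: upper_def)
  qed
qed

lemma aztec_verts_eq: "aztec_verts m = upper \<union> refl_h ` upper"
proof
  show "upper \<union> refl_h ` upper \<subseteq> aztec_verts m"
    unfolding upper_eq by (auto simp: refl_h_def aztec_verts_neg)
  show "aztec_verts m \<subseteq> upper \<union> refl_h ` upper"
  proof clarify
    fix x y assume xy: "(x, y) \<in> aztec_verts m" "(x, y) \<notin> refl_h ` upper"
    have "y > 0"
    proof (rule ccontr)
      assume "\<not> y > 0"
      then have "- y > 0" using aztec_verts_abs[OF xy(1)] by linarith
      then have "(x, - y) \<in> upper" using aztec_verts_neg(1)[OF xy(1)] by (simp add: upper_eq)
      then have "refl_h (x, - y) \<in> refl_h ` upper" by (rule imageI)
      then show False using xy(2) by (simp add: refl_h_def)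
    qed
    then show "(x, y) \<in> upper" using xy(1) by (simp add: upper_eq)
  qed
qed

lemma finite_aztec_verts: "finite (aztec_verts m)"
  unfolding aztec_verts_eq upper_def using finite_V by simp

text \<open>The taxicab distance of the images is the larger of the two coordinate differences.
  Between black squares these differences have equal parity, so if the larger is 1, both
  are.\<close>

lemma plane_arc_iff:
  assumes "u \<in> V" "v \<in> V"
  shows "(plane u, plane v) \<in> aztec_arcs m \<longleftrightarrow> (u, v) \<in> A"
proof -
  obtain i j i' j' where uv: "u = (i, j)" "v = (i', j')" by (metis prod.exhaust)
  have par: "even (i + j)" "even (i' + j')" using assms by (auto simp: uv V_def)
  have in_verts: "plane u \<in> aztec_verts m" "plane v \<in> aztec_verts m"
    using assms unfolding aztec_verts_eq upper_def by auto
  have "\<bar>fst (plane u) - fst (plane v)\<bar> + \<bar>snd (plane u) - snd (plane v)\<bar> =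
      of_int (max \<bar>i - i'\<bar> \<bar>j - j'\<bar>)"
    unfolding uv plane_def by (simp add: abs_if max_def field_simps)
  then have "(plane u, plane v) \<in> aztec_arcs m \<longleftrightarrow> max \<bar>i - i'\<bar> \<bar>j - j'\<bar> = 1"
    using in_verts by (simp add: aztec_arcs_def case_prod_unfold)
  also have "\<dots> \<longleftrightarrow> \<bar>i - i'\<bar> = 1 \<and> \<bar>j - j'\<bar> = 1"
    using par by presburger
  also have "\<dots> \<longleftrightarrow> (u, v) \<in> A" using assms by (simp add: uv A_def)
  finally show ?thesis .
qed

lemma upper_arcs: "aztec_arcs m \<inter> upper \<times> upper = map_prod plane plane ` A"
proof (rule map_prod_image_eq[symmetric])
  show "plane ` V = upper" by (simp add: upper_def)
  show "(u, v) \<in> A \<longleftrightarrow> (plane u, plane v) \<in> aztec_arcs m \<inter> upper \<times> upper"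
    if "u \<in> V" "v \<in> V" for u v
    using plane_arc_iff[OF that] that by (simp add: upper_def)
qed (use A_subset in auto)

lemma reflected_graph_aztec: "reflected_graph upper refl_h (aztec_arcs m)"
proof
  show "finite upper" unfolding upper_def using finite_V by simp
  show "aztec_arcs m \<subseteq> (upper \<union> refl_h ` upper) \<times> (upper \<union> refl_h ` upper)"
    using aztec_arcs_subset[of m] by (simp only: aztec_verts_eq)
  show "sym (aztec_arcs m)" by (auto simp: sym_def aztec_arcs_def abs_minus_commute)
  show "refl_h (refl_h v) = v" for v by (cases v) (simp add: refl_h_def)
  show "upper \<inter> refl_h ` upper = {}" by (auto simp: upper_eq refl_h_def)
  fix u v assume uv: "(u, v) \<in> aztec_arcs m"
  then show "(refl_h u, refl_h v) \<in> aztec_arcs m"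
    by (auto simp: aztec_arcs_def refl_h_def aztec_verts_neg)
  show "v = refl_h u" if "u \<in> upper" "v \<notin> upper"
  proof -
    obtain x y x' y' where eq: "u = (x, y)" "v = (x', y')" by (metis prod.exhaust)
    have 1: "(x, y) \<in> aztec_verts m" "(x', y') \<in> aztec_verts m" "\<bar>x - x'\<bar> + \<bar>y - y'\<bar> = 1"
      using uv by (auto simp: eq aztec_arcs_def)
    moreover have "y > 0" "\<not> y' > 0"
      using \<open>u \<in> upper\<close> \<open>v \<notin> upper\<close> 1 by (auto simp: eq upper_eq)
    \<comment> \<open>Every vertex is at least 1/2 away from the axis, so a unit edge across it is
      vertical and centred.\<close>
    ultimately have "x = x'" "y' = - y" using aztec_verts_abs[OF 1(1)] aztec_verts_abs[OF 1(2)] by linarith+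
    then show "v = refl_h u" by (simp add: eq refl_h_def)
  qed
qed

text \<open>A crossing edge has its upper end at height 1/2, that is, at one of the
  \<open>2 m\<close> squares of the diagonal.\<close>

lemma card_crossing_edges: "card {u \<in> upper. (u, refl_h u) \<in> aztec_arcs m} = 2 * m"
proof -
  have "{u \<in> upper. (u, refl_h u) \<in> aztec_arcs m} = (\<lambda>i. plane (int i, int i)) ` {..<2 * m}"
  proof
    show "(\<lambda>i. plane (int i, int i)) ` {..<2 * m} \<subseteq> {u \<in> upper. (u, refl_h u) \<in> aztec_arcs m}"
    proof (rule image_subsetI)
      fix i assume "i \<in> {..<2 * m}"
      then have "(int i, int i) \<in> V" by (simp add: V_def)
      then have u: "plane (int i, int i) \<in> upper" by (simp add: upper_def)
      then have "plane (int i, int i) \<in> aztec_verts m" "refl_h (plane (int i, int i)) \<in> aztec_verts m"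
        by (auto simp: aztec_verts_eq)
      then have "(plane (int i, int i), refl_h (plane (int i, int i))) \<in> aztec_arcs m"
        by (simp add: aztec_arcs_def plane_def refl_h_def)
      with u show "plane (int i, int i) \<in> {u \<in> upper. (u, refl_h u) \<in> aztec_arcs m}" by simp
    qed
    show "{u \<in> upper. (u, refl_h u) \<in> aztec_arcs m} \<subseteq> (\<lambda>i. plane (int i, int i)) ` {..<2 * m}"
    proof clarify
      fix x y assume u: "(x, y) \<in> upper" "((x, y), refl_h (x, y)) \<in> aztec_arcs m"
      then obtain i j where ij: "(i, j) \<in> V" "(x, y) = plane (i, j)" by (auto simp: upper_def)
      have "y > 0" using u(1) by (simp add: upper_eq)
      moreover have "\<bar>2 * y\<bar> = 1" using u(2) by (simp add: aztec_arcs_def refl_h_def)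
      ultimately have "i = j" using ij(2) by (simp add: plane_def)
      then have "(x, y) = plane (int (nat i), int (nat i))" "nat i < 2 * m"
        using ij by (auto simp: V_def)
      then show "(x, y) \<in> (\<lambda>i. plane (int i, int i)) ` {..<2 * m}" by blast
    qed
  qed
  moreover have "inj_on (\<lambda>i. plane (int i, int i)) {..<2 * m}"
    by (rule inj_onI) (use injD[OF inj_plane] in force)
  ultimately show ?thesis by (simp add: card_image)
qed

lemma card_invariant_aztec:
  "card {R. R \<subseteq> aztec_arcs m \<and> tree_on (aztec_verts m) R \<and> map_prod refl_h refl_h ` R = R} =
    2 * m * card {R. R \<subseteq> A \<and> tree_on V R}"
proof -
  interpret R: reflected_graph upper refl_h "aztec_arcs m" by (rule reflected_graph_aztec)
  have "upper \<noteq> {}" using V_ne by (simp add: upper_def)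
  from R.card_invariant_trees[OF this] show ?thesis
    unfolding aztec_verts_eq[symmetric] card_crossing_edges upper_arcs
    unfolding upper_def card_trees_image[OF inj_on_subset[OF inj_plane subset_UNIV] A_subset] .
qed

lemma num_spanning_trees_half_mixed:
  "num_spanning_trees (half_mixed_aztec_diamond m) = card {R. R \<subseteq> A \<and> tree_on V R}"
proof -
  let ?B = "black_squares m" and ?g = "map_prod int int"
  let ?W = "{(i, j) \<in> ?B. i \<le> j}"
  let ?C = "{(s, t). s \<in> ?W \<and> t \<in> ?W \<and> s \<noteq> t \<and> corners s \<inter> corners t \<noteq> {}}"
  have restr: "W \<subseteq> B \<Longrightarrow> {(s, t). s \<in> B \<and> t \<in> B \<and> P s t} \<inter> W \<times> W = {(s, t). s \<in> W \<and> t \<in> W \<and> P s t}"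
    for W B :: "(nat \<times> nat) set" and P
    by blast
  have "{(s, t). s \<in> ?B \<and> t \<in> ?B \<and> s \<noteq> t \<and> corners s \<inter> corners t \<noteq> {}} \<inter> ?W \<times> ?W = ?C"
    by (rule restr) auto
  then have G: "half_mixed_aztec_diamond m = with_proj \<lparr> pverts = ?W, parcs = ?C \<rparr>"
    unfolding half_mixed_aztec_diamond_def mixed_aztec_diamond_def with_proj_restrict
    by (simp only: pair_pre_digraph.simps)
  have gW: "?g ` ?W = V"
  proof
    show "?g ` ?W \<subseteq> V" by (auto simp: V_def black_squares_def)
    show "V \<subseteq> ?g ` ?W"
    proof clarify
      fix i j assume "(i, j) \<in> V"
      moreover from this have "0 \<le> i" "0 \<le> j" by (auto simp: V_def)
      then obtain a b where ab: "i = int a" "j = int b" by (metis zero_le_imp_eq_int)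
      ultimately have "(a, b) \<in> ?W" by (auto simp: V_def black_squares_def)
      then have "?g (a, b) \<in> ?g ` ?W" by (rule imageI)
      then show "(i, j) \<in> ?g ` ?W" by (simp only: ab map_prod_simp)
    qed
  qed
  have C: "(s, t) \<in> ?C \<longleftrightarrow> (?g s, ?g t) \<in> A" if st: "s \<in> ?W" "t \<in> ?W" for s t
  proof -
    obtain i j i' j' where eq: "s = (i, j)" "t = (i', j')" by (metis prod.exhaust)
    have par: "even (i + j)" "even (i' + j')" using st by (auto simp: eq black_squares_def)
    have "corners s \<inter> corners t \<noteq> {} \<longleftrightarrow> {i, i + 1} \<inter> {i', i' + 1} \<noteq> {} \<and> {j, j + 1} \<inter> {j', j' + 1} \<noteq> {}"
      unfolding eq corners_def by blast
    also have "\<dots> \<longleftrightarrow> \<bar>int i - int i'\<bar> \<le> 1 \<and> \<bar>int j - int j'\<bar> \<le> 1" by auto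
    finally have "(s, t) \<in> ?C \<longleftrightarrow> (i, j) \<noteq> (i', j') \<and> \<bar>int i - int i'\<bar> \<le> 1 \<and> \<bar>int j - int j'\<bar> \<le> 1"
      using st eq by simp
    \<comment> \<open>Squares with a common side share corners too, but they differ in
      colour.\<close>
    also have "\<dots> \<longleftrightarrow> \<bar>int i - int i'\<bar> = 1 \<and> \<bar>int j - int j'\<bar> = 1"
      using par unfolding prod.inject by presburger
    also have "\<dots> \<longleftrightarrow> (?g s, ?g t) \<in> A"
    proof -
      have "?g s \<in> V" "?g t \<in> V" using st gW by blast+
      then show ?thesis by (simp add: eq A_def)
    qed
    finally show ?thesis .
  qed
  have gC: "map_prod ?g ?g ` ?C = A"
  proof (rule map_prod_image_eq)
    show "?g ` ?W = V" by (rule gW)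
    show "?C \<subseteq> ?W \<times> ?W" by blast
    show "A \<subseteq> V \<times> V" by (rule A_subset)
    show "(s, t) \<in> ?C \<longleftrightarrow> (?g s, ?g t) \<in> A" if "s \<in> ?W" "t \<in> ?W" for s t
      using that by (rule C)
  qed
  have inj: "inj_on ?g ?W" by (auto simp: inj_on_def)
  have "num_spanning_trees (half_mixed_aztec_diamond m) = card {R. R \<subseteq> ?C \<and> tree_on ?W R}"
    unfolding G
  proof (rule num_spanning_trees_eq)
    show "?W \<noteq> {}" using gW V_ne by auto
  qed (auto simp: irrefl_def)
  also have "\<dots> = card {R. R \<subseteq> map_prod ?g ?g ` ?C \<and> tree_on (?g ` ?W) R}"
    by (rule card_trees_image[symmetric]) (use inj in auto)
  finally show ?thesis unfolding gC gW .
qed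

lemma no_invariant_spanning_trees:
  assumes "rot90 \<circ> rot90 \<in> H"
  shows "num_invariant_spanning_trees H (aztec_diamond m) = 0"
proof -
  have ne: "aztec_verts m \<noteq> {}" using V_ne by (simp add: aztec_verts_eq upper_def)
  have False if T: "undirected_spanning_tree T (aztec_diamond m)" "graph_invariant (rot90 \<circ> rot90) T" for T
  proof -
    obtain R where R: "R \<subseteq> aztec_arcs m" "tree_on (aztec_verts m) R"
      "T = with_proj \<lparr> pverts = aztec_verts m, parcs = R \<rparr>"
      using T(1) undirected_spanning_tree_iff[OF aztec_arcs_subset irrefl_aztec_arcs ne]
      unfolding aztec_diamond_eq by blast
    have r: "rot90 \<circ> rot90 = (\<lambda>(x, y). (- x, - y))" by (auto simp: rot90_def)
    show False
    proof (rule no_tree_invariant_under_free_involution[OF R(2) finite_aztec_verts ne, of "rot90 \<circ> rot90"])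
      show "(rot90 \<circ> rot90) ((rot90 \<circ> rot90) v) = v" for v by (cases v) (simp add: r)
      show "(rot90 \<circ> rot90) ` aztec_verts m = aztec_verts m"
        "map_prod (rot90 \<circ> rot90) (rot90 \<circ> rot90) ` R = R"
        using T(2) by (simp_all add: R(3) graph_invariant_def)
      show "(rot90 \<circ> rot90) v \<noteq> v" if "v \<in> aztec_verts m" for v
        using aztec_verts_abs[of "fst v" "snd v" m] that by (cases v) (auto simp: r)
      \<comment> \<open>Antipodal vertices have distance
        \<open>2 (\<bar>x\<bar> + \<bar>y\<bar>)\<close>, which is at least 2.\<close>
      show "(v, (rot90 \<circ> rot90) v) \<notin> R" for v
      proof
        assume "(v, (rot90 \<circ> rot90) v) \<in> R"
        then have "(v, (rot90 \<circ> rot90) v) \<in> aztec_arcs m" using R(1) by blast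
        then show False
          using aztec_verts_abs[of "fst v" "snd v" m] by (cases v) (auto simp: r aztec_arcs_def)
      qed
    qed
  qed
  then have "{T. undirected_spanning_tree T (aztec_diamond m) \<and> (\<forall>\<sigma>\<in>H. graph_invariant \<sigma> T)} = {}"
    using assms by blast
  then show ?thesis unfolding num_invariant_spanning_trees_def by (simp only: card.empty)
qed

end

section \<open>The groups generated by the symmetries\<close>

lemma mult_BijGroup_UNIV: "f \<in> Bij UNIV \<Longrightarrow> g \<in> Bij UNIV \<Longrightarrow> f \<otimes>\<^bsub>BijGroup UNIV\<^esub> g = f \<circ> g"
  by (simp add: BijGroup_def compose_def o_def restrict_def)

lemma involution_Bij: "(\<And>x. f (f x) = x) \<Longrightarrow> f \<in> Bij UNIV"
  unfolding Bij_def by (auto intro: o_bij[of f f] simp: fun_eq_iff)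

lemma refl_Bij: "refl_h \<in> Bij UNIV" "refl_v \<in> Bij UNIV"
  by (rule involution_Bij, simp add: refl_h_def refl_v_def case_prod_unfold)+

lemma rot90_Bij: "rot90 \<in> Bij UNIV"
  unfolding Bij_def by (auto intro!: o_bij[of "\<lambda>(x, y). (y, - x)"] simp: fun_eq_iff rot90_def)

text \<open>The half-turn is the square of the rotation and the product of the two reflections, so
  the three classes are empty for one and the same reason.\<close>

lemma half_turn_in_sym_group:
  "rot90 \<circ> rot90 \<in> sym_group {rot90 \<circ> rot90}"
  "rot90 \<circ> rot90 \<in> sym_group {rot90}"
  "rot90 \<circ> rot90 \<in> sym_group {refl_h, refl_v}"
proof -
  show "rot90 \<circ> rot90 \<in> sym_group {rot90 \<circ> rot90}"
    unfolding sym_group_def by (rule generate.incl) simp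
  have "rot90 \<otimes>\<^bsub>BijGroup UNIV\<^esub> rot90 \<in> sym_group {rot90}"
    unfolding sym_group_def by (intro generate.eng generate.incl) simp_all
  then show "rot90 \<circ> rot90 \<in> sym_group {rot90}"
    by (simp add: mult_BijGroup_UNIV rot90_Bij)
  have "refl_h \<otimes>\<^bsub>BijGroup UNIV\<^esub> refl_v \<in> sym_group {refl_h, refl_v}"
    unfolding sym_group_def by (intro generate.eng generate.incl) simp_all
  moreover have "refl_h \<circ> refl_v = rot90 \<circ> rot90"
    by (auto simp: refl_h_def refl_v_def rot90_def)
  ultimately show "rot90 \<circ> rot90 \<in> sym_group {refl_h, refl_v}"
    by (simp add: mult_BijGroup_UNIV refl_Bij)
qed

lemma sym_group_refl_h: "sym_group {refl_h} = {id, refl_h}"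
proof -
  have hh: "refl_h \<circ> refl_h = id" by (auto simp: refl_h_def)
  have one: "\<one>\<^bsub>BijGroup UNIV\<^esub> = id" by (simp add: BijGroup_def restrict_def id_def)
  have id: "id \<in> Bij UNIV" by (rule involution_Bij) simp
  have "x \<in> generate (BijGroup UNIV) {refl_h} \<Longrightarrow> x \<in> {id, refl_h}" for x
  proof (induction rule: generate.induct)
    case (inv h)
    have "inv\<^bsub>BijGroup UNIV\<^esub> refl_h = refl_h"
      by (rule group.inv_equality[OF group_BijGroup])
        (simp_all add: mult_BijGroup_UNIV refl_Bij hh one, simp_all add: BijGroup_def refl_Bij)
    with inv show ?case by simp
  next
    case (eng h1 h2)
    then have "h1 \<in> Bij UNIV" "h2 \<in> Bij UNIV" using id refl_Bij by blast+
    then have "h1 \<otimes>\<^bsub>BijGroup UNIV\<^esub> h2 = h1 \<circ> h2" by (rule mult_BijGroup_UNIV)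
    also have "\<dots> \<in> {id, refl_h}" using eng.IH hh by (metis comp_id id_comp insert_iff singletonD)
    finally show ?case .
  qed (simp_all add: one)
  moreover have "id \<in> sym_group {refl_h}" "refl_h \<in> sym_group {refl_h}"
    unfolding sym_group_def using generate.one[of "BijGroup UNIV" "{refl_h}"] generate.incl[of refl_h "{refl_h}"]
    by (simp_all add: one)
  ultimately show ?thesis unfolding sym_group_def by blast
qed

text \<open>Serves to show that horizontally symmetric trees exist. A frequency strictly between 0
  and \<open>2 m\<close> keeps the cosine away from 1 and -1.\<close>

lemma prod_modes_pos:
  "(\<Prod>(j, k)\<in>mode_index m. 4 - 4 * cos (real j * pi / (2 * real m)) * cos (real k * pi / (2 * real m))) > 0"
proof (rule prod_pos, clarify)
  fix j k assume jk: "(j, k) \<in> mode_index m"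
  have "\<bar>cos (real j * pi / (2 * real m))\<bar> < 1"
  proof -
    have b: "0 < real j * pi / (2 * real m)" "real j * pi / (2 * real m) < pi"
      using jk by (auto simp: mode_index_def field_simps)
    have "cos (real j * pi / (2 * real m)) < 1" "cos (real j * pi / (2 * real m)) > -1"
      using cos_monotone_0_pi[of 0 "real j * pi / (2 * real m)"] cos_monotone_0_pi[of "real j * pi / (2 * real m)" pi] b
      by simp_all
    then show ?thesis by simp
  qed
  moreover have "\<bar>cos (real k * pi / (2 * real m))\<bar> \<le> 1" by simp
  ultimately have "\<bar>cos (real j * pi / (2 * real m)) * cos (real k * pi / (2 * real m))\<bar> < 1"
    unfolding abs_mult by (metis abs_ge_zero mult.right_neutral mult_left_le order.strict_trans1)
  then show "0 < 4 - 4 * cos (real j * pi / (2 * real m)) * cos (real k * pi / (2 * real m))"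
    by (simp add: abs_less_iff)
qed

theorem theorem4p4:
  fixes n :: nat
  assumes "n \<ge> 1"
  shows
    "num_invariant_spanning_trees (sym_group {refl_h, refl_v}) (aztec_diamond n) = 0 \<and>
     num_invariant_spanning_trees (sym_group {rot90 \<circ> rot90}) (aztec_diamond n) = 0 \<and>
     num_invariant_spanning_trees (sym_group {rot90}) (aztec_diamond n) = 0 \<and>
     num_invariant_spanning_trees (sym_group {refl_h}) (aztec_diamond n) > 0 \<and>
     num_invariant_spanning_trees (sym_group {refl_h}) (aztec_diamond n)
       = 2 * n * num_spanning_trees (half_mixed_aztec_diamond n) \<and>
     real (2 * n * num_spanning_trees (half_mixed_aztec_diamond n))
       = 2 * real n *
         (\<Prod>(j, k) \<in> {(j :: nat, k :: nat). 1 \<le> j \<and> j < k \<and> k \<le> 2 * n - 1 \<and> j + k \<le> 2 * n - 1}.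
            4 - 4 * cos (real j * pi / (2 * real n)) * cos (real k * pi / (2 * real n)))"
proof -
  interpret half_board_nat n by unfold_locales (rule assms)
  let ?t = "card {R. R \<subseteq> A \<and> tree_on V R}"
  have "num_invariant_spanning_trees (sym_group {refl_h}) (aztec_diamond n) = 2 * n * ?t"
  proof -
    have "num_invariant_spanning_trees (sym_group {refl_h}) (aztec_diamond n) =
        card {R. R \<subseteq> aztec_arcs n \<and> tree_on (aztec_verts n) R \<and> (\<forall>\<sigma>\<in>{id, refl_h}. map_prod \<sigma> \<sigma> ` R = R)}"
      unfolding aztec_diamond_eq sym_group_refl_h
    proof (rule num_invariant_spanning_trees_eq[OF aztec_arcs_subset irrefl_aztec_arcs])
      show "aztec_verts n \<noteq> {}" using V_ne by (simp add: aztec_verts_eq upper_def)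
      have "refl_h ` refl_h ` upper = upper" by (auto simp: image_image refl_h_def case_prod_unfold)
      then have "refl_h ` aztec_verts n = aztec_verts n"
        by (simp add: aztec_verts_eq image_Un Un_commute)
      then show "\<sigma> ` aztec_verts n = aztec_verts n" if "\<sigma> \<in> {id, refl_h}" for \<sigma> using that by auto
    qed
    then show ?thesis using card_invariant_aztec by (simp add: prod.map_id0)
  qed
  moreover have "real ?t > 0"
    unfolding card_spanning_trees_formula by (rule prod_modes_pos)
  ultimately show ?thesis
    using half_turn_in_sym_group no_invariant_spanning_trees num_spanning_trees_half_mixed
      card_spanning_trees_formula assms by (simp add: mode_index_def)
qed

end
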